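(* Let $X$ and $S$ be completely regular topological spaces, let $Y=X$, and let $\pi^{+}, \pi^{-} \in \mathcal M_{+}(X \times S)$ be nonnegative Radon measures. Then the maximum in the optimal exchange problem with unit cost, $\max_{\gamma\in\Gamma(\pi^{+},\pi^{-})}\gamma(X\times Y\times S)$, is equal to $$ \inf_{u \in C_b(X),\, v \in C_b(S)} \Bigl\{\int_{X \times S} [u(x) + v(s)]_{+}\, \pi^{+}(dx \, ds) + \int_{X \times S} [1 - u(x) - v(s)]_{+}\, \pi^{-}(dx \, ds) \Bigr\}. $$
   Context: For a topological space $Z$, $\mathcal M_{+}(Z)$ denotes the set of finite nonnegative Radon measures on $Z$: Borel measures $\mu$ such that for every Borel set $B$ and every $\varepsilon>0$ there is a compact set $K\subset B$ with $\mu(B\setminus K)<\varepsilon$. $C_b(Z)$ is the space of bounded continuous real functions on $Z$; $[t]_{+}=\max(t,0)$. $Pr$ with a subscript denotes the projection (image measure) of a measure on the indicated factors. Inequalities between measures are setwise on Borel sets. $Y$ is a copy of $X$, and $\pi^{-}$ is regarded as a measure on $Y\times S$ where needed. $\Gamma(\pi^{+}, \pi^{-})$ is the set of all $\gamma \in \mathcal M_{+}(X \times Y \times S)$ such that $Pr_{X \times S}(\gamma) \le \pi^{+}$, $Pr_{Y \times S}(\gamma) \le \pi^{-}$, and $Pr_X(\gamma)=Pr_Y(\gamma)$ (as measures on $X=Y$). The optimal exchange problem with unit cost is to maximize $\gamma(X\times Y\times S)$ over $\gamma\in\Gamma(\pi^{+}, \pi^{-})$. *)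

theory Defs
  imports "HOL-Analysis.Analysis"
begin

(* No Hausdorff axiom is assumed, so a compact set need not be Borel; K \<in> sets borel keeps
   measure M (B - K) meaningful and holds automatically in Hausdorff spaces. *)
definition radon_measures :: "'a::topological_space measure set" where
  "radon_measures = {M. sets M = sets borel \<and> finite_measure M \<and>
     (\<forall>B \<in> sets borel. \<forall>e > 0. \<exists>K. compact K \<and> K \<in> sets borel \<and> K \<subseteq> B \<and> measure M (B - K) < e)}"

(* Borel means Borel for the product topology, which in general is larger than the product
   sigma-algebra. The library order on measures is lexicographic in space and sets, so the
   inequalities between measures are spelled out setwise. *)
definition exchange_plans ::
  "('x::topological_space \<times> 's::topological_space) measure \<Rightarrow> ('x \<times> 's) measure \<Rightarrow>
     ('x \<times> 'x \<times> 's) measure set" where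
  "exchange_plans \<pi>p \<pi>m = {\<gamma> \<in> radon_measures.
     (\<forall>B \<in> sets borel. emeasure (distr \<gamma> borel (\<lambda>(x, y, s). (x, s))) B \<le> emeasure \<pi>p B) \<and>
     (\<forall>B \<in> sets borel. emeasure (distr \<gamma> borel (\<lambda>(x, y, s). (y, s))) B \<le> emeasure \<pi>m B) \<and>
     distr \<gamma> borel (\<lambda>(x, y, s). x) = distr \<gamma> borel (\<lambda>(x, y, s). y)}"

definition dual_cost ::
  "('x::topological_space \<times> 's::topological_space) measure \<Rightarrow> ('x \<times> 's) measure \<Rightarrow>
     ('x \<Rightarrow> real) \<Rightarrow> ('s \<Rightarrow> real) \<Rightarrow> real" where
  "dual_cost \<pi>p \<pi>m u v =
     (\<integral>(x, s). max (u x + v s) 0 \<partial>\<pi>p) + (\<integral>(x, s). max (1 - u x - v s) 0 \<partial>\<pi>m)"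

end

theory Submission
  imports Defs
begin

text \<open>Weak duality is integration of \<open>1 \<le> [u(x) + v(s)]\<^sub>+ + [1 - u(y) - v(s)]\<^sub>+ + u(y) - u(x)\<close>.
  For the converse, let \<open>P(h)\<close> be the infimum of \<open>\<integral> [a]\<^sub>+ d\<pi>\<^sup>+ + \<integral> [b]\<^sub>+ d\<pi>\<^sup>-\<close> over continuous bounded
  \<open>a, b, u\<close> with \<open>h(x, y, s) \<le> a(x, s) + b(y, s) + u(x) - u(y)\<close>. This is a sublinear functional, and
  Hahn-Banach gives a linear \<open>L \<le> P\<close> with \<open>L(1) = P(1)\<close>. It is positive, and tight because the
  marginals \<open>\<pi>\<^sup>+\<close>, \<open>\<pi>\<^sup>-\<close> are Radon, so it is represented by a Radon measure. The bound \<open>L \<le> P\<close> says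
  exactly that this measure is an exchange plan, and its mass \<open>P(1)\<close> is the dual value.\<close>

section \<open>The Hahn-Banach theorem for sublinear functionals\<close>

text \<open>Neither \<open>X\<close> nor \<open>S\<close> is compact, so a positive functional on
  bounded continuous functions could be merely finitely additive. What excludes this: a point
  outside a product of compact sets leaves it in \<open>x\<close> or \<open>s\<close>, seen by
  \<open>\<pi>p\<close>, or in \<open>y\<close>, seen by \<open>\<pi>m\<close>, and both measures
  are small off a compact set.

  In P the functions a and b are arbitrary on \<open>X \<times> S\<close>, a wider class than the
  dual pairs, because setwise domination of a marginal requires testing \<open>L \<le> P\<close>
  with every function of (x, s). That P(1) is nevertheless no smaller than the dual value is a
  separation statement: the constraint puts x on one side and y on the other with s shared, so some
  function of s alone fits between. It need not be continuous, and Radon regularity is used once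
  more to approximate it.

  The normalization L(1) = P(1) turns the supremum into a maximum without any limit of plans. The
  lack of a Hausdorff axiom forces closures and separate closedness claims wherever compact sets
  occur.\<close>

definition sublinear :: "('v::real_vector \<Rightarrow> real) \<Rightarrow> bool" where
  "sublinear p \<longleftrightarrow> (\<forall>x y. p (x + y) \<le> p x + p y) \<and> (\<forall>c>0. \<forall>x. p (c *\<^sub>R x) \<le> c * p x)"

lemma sublinearI:
  assumes "\<And>x y. p (x + y) \<le> p x + p y" and "\<And>c x. c > 0 \<Longrightarrow> p (c *\<^sub>R x) \<le> c * p x"
  shows "sublinear p"
  using assms by (simp add: sublinear_def)

lemma sublinear_add: "sublinear p \<Longrightarrow> p (x + y) \<le> p x + p y"
  by (simp add: sublinear_def)

lemma sublinear_scale_le: "sublinear p \<Longrightarrow> c > 0 \<Longrightarrow> p (c *\<^sub>R x) \<le> c * p x"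
  by (simp add: sublinear_def)

lemma sublinear_zero:
  assumes "sublinear p"
  shows "p 0 = 0"
  using sublinear_scale_le[OF assms, of 2 0] sublinear_scale_le[OF assms, of "1/2" 0] by simp

text \<open>The reverse inequality is the defining one with factor \<open>1 / c\<close>, applied to
  \<open>c *\<^sub>R x\<close>. This is why \<open>sublinear\<close> asks only for an inequality,
  which is easier to verify for functionals given as infima.\<close>

lemma sublinear_scale:
  assumes "sublinear p" "c \<ge> 0"
  shows "p (c *\<^sub>R x) = c * p x"
proof (cases "c = 0")
  case True
  then show ?thesis using sublinear_zero[OF assms(1)] by simp
next
  case False
  with assms have c: "c > 0" by simp
  have "p x \<le> (1 / c) * p (c *\<^sub>R x)"
    using sublinear_scale_le[OF assms(1), of "1 / c" "c *\<^sub>R x"] c by simp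
  then have "c * p x \<le> p (c *\<^sub>R x)" using c by (simp add: field_simps)
  with sublinear_scale_le[OF assms(1) c, of x] show ?thesis by simp
qed

lemma sublinear_minus: "sublinear p \<Longrightarrow> - p (- x) \<le> p x"
  using sublinear_add[of p x "- x"] sublinear_zero[of p] by simp

text \<open>The function \<open>x \<mapsto> inf\<^sub>t (p (x + t y) - t p y)\<close> lowers \<open>p\<close> so as to make it odd at \<open>y\<close>; hence a
  minimal sublinear functional is linear.\<close>

lemma sublinear_reduce:
  assumes p: "sublinear p"
  obtains q where "sublinear q" "q \<le> p" "q (- y) \<le> - p y"
proof -
  define g where "g x t = p (x + t *\<^sub>R y) - t * p y" for x t
  define q where "q x = (INF t\<in>{0..}. g x t)" for x
  \<comment> \<open>Subadditivity on \<open>t *\<^sub>R y = (x + t *\<^sub>R y) + (- x)\<close>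
    gives a lower bound independent of \<open>t\<close>, so the infimum is a real number.\<close>
  have bdd: "bdd_below (g x ` {0..})" for x
  proof (rule bdd_belowI2)
    fix t :: real assume "t \<in> {0..}"
    then show "- p (- x) \<le> g x t"
      using sublinear_add[OF p, of "x + t *\<^sub>R y" "- x"] sublinear_scale[OF p, of t y]
      by (simp add: g_def)
  qed
  have q_le: "q x \<le> g x t" if "t \<ge> 0" for x t
    unfolding q_def using that by (intro cINF_lower bdd) auto
  have q_ge: "c \<le> q x" if "\<And>t. t \<ge> 0 \<Longrightarrow> c \<le> g x t" for c x
    unfolding q_def using that by (intro cINF_greatest) auto
  have "sublinear q"
  proof (rule sublinearI)
    fix x z
    \<comment> \<open>The two infima are removed one after the other; parameters \<open>t\<close>
      for \<open>x\<close> and \<open>s\<close> for \<open>z\<close> combine to the admissible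
      parameter \<open>t + s\<close> for \<open>x + z\<close>.\<close>
    have "q (x + z) - g x t \<le> q z" if t: "t \<ge> 0" for t
    proof (rule q_ge)
      fix s :: real assume s: "s \<ge> 0"
      have "q (x + z) \<le> g (x + z) (t + s)" using s t by (intro q_le) simp
      also have "\<dots> \<le> g x t + g z s"
        using sublinear_add[OF p, of "x + t *\<^sub>R y" "z + s *\<^sub>R y"]
        by (simp add: g_def algebra_simps)
      finally show "q (x + z) - g x t \<le> g z s" by simp
    qed
    then have "q (x + z) - q z \<le> q x" by (intro q_ge) (simp add: algebra_simps)
    then show "q (x + z) \<le> q x + q z" by simp
  next
    fix c :: real and x assume c: "c > 0"
    have "q (c *\<^sub>R x) / c \<le> q x"
    proof (rule q_ge)
      fix t :: real assume t: "t \<ge> 0"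
      have "q (c *\<^sub>R x) \<le> g (c *\<^sub>R x) (c * t)" using c t by (intro q_le) simp
      also have "\<dots> = p (c *\<^sub>R (x + t *\<^sub>R y)) - c * (t * p y)"
        by (simp add: g_def algebra_simps)
      also have "\<dots> = c * g x t"
        using sublinear_scale[OF p, of c "x + t *\<^sub>R y"] c by (simp add: g_def right_diff_distrib)
      finally show "q (c *\<^sub>R x) / c \<le> g x t" using c by (simp add: field_simps)
    qed
    then show "q (c *\<^sub>R x) \<le> c * q x" using c by (simp add: field_simps)
  qed
  moreover have "q \<le> p" using q_le[of 0] by (simp add: le_fun_def g_def)
  moreover have "q (- y) \<le> - p y"
    using q_le[of 1 "- y"] sublinear_zero[OF p] by (simp add: g_def)
  ultimately show thesis by (rule that)
qed

text \<open>A pointwise infimum of sublinear functionals is in general not subadditive. In a chain,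
  any \<open>q\<close> and \<open>r\<close> have a common lower member \<open>s\<close>, and
  subadditivity of \<open>s\<close> serves both. The common majorant \<open>p\<close> gives the
  lower bound \<open>- p (- x)\<close>.\<close>

lemma sublinear_INF_chain:
  assumes "C \<noteq> {}" and sub: "\<And>q. q \<in> C \<Longrightarrow> sublinear q"
    and chain: "\<And>q r. q \<in> C \<Longrightarrow> r \<in> C \<Longrightarrow> q \<le> r \<or> r \<le> q"
    and le: "\<And>q. q \<in> C \<Longrightarrow> q \<le> p"
  obtains u where "sublinear u" "\<And>q. q \<in> C \<Longrightarrow> u \<le> q"
proof -
  define u where "u x = (INF q\<in>C. q x)" for x
  have bdd: "bdd_below ((\<lambda>q. q x) ` C)" for x
  proof (rule bdd_belowI2)
    fix q assume "q \<in> C"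
    then show "- p (- x) \<le> q x"
      using sublinear_minus[OF sub, of q x] le_funD[OF le, of q "- x"] by simp
  qed
  have u_le: "u x \<le> q x" if "q \<in> C" for q x
    unfolding u_def using that by (intro cINF_lower bdd)
  have u_ge: "c \<le> u x" if "\<And>q. q \<in> C \<Longrightarrow> c \<le> q x" for c x
    unfolding u_def using that \<open>C \<noteq> {}\<close> by (intro cINF_greatest)
  have "sublinear u"
  proof (rule sublinearI)
    fix x y
    have "u (x + y) - q x \<le> u y" if q: "q \<in> C" for q
    proof (rule u_ge)
      fix r assume r: "r \<in> C"
      obtain s where s: "s \<in> C" "s \<le> q" "s \<le> r" using chain[OF q r] q r by blast
      have "u (x + y) \<le> s (x + y)" using s u_le by blast
      also have "\<dots> \<le> s x + s y" using sub s(1) sublinear_add by blast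
      also have "\<dots> \<le> q x + r y" using s by (intro add_mono) (auto simp: le_fun_def)
      finally show "u (x + y) - q x \<le> r y" by simp
    qed
    then have "u (x + y) - u y \<le> u x" by (intro u_ge) (simp add: algebra_simps)
    then show "u (x + y) \<le> u x + u y" by simp
  next
    fix c :: real and x assume c: "c > 0"
    have "u (c *\<^sub>R x) / c \<le> u x"
    proof (rule u_ge)
      fix q assume q: "q \<in> C"
      have "u (c *\<^sub>R x) \<le> q (c *\<^sub>R x)" using q u_le by blast
      also have "\<dots> \<le> c * q x" using sublinear_scale_le[OF sub[OF q] c] .
      finally show "u (c *\<^sub>R x) / c \<le> q x" using c by (simp add: field_simps)
    qed
    then show "u (c *\<^sub>R x) \<le> c * u x" using c by (simp add: field_simps)
  qed
  moreover have "\<And>q. q \<in> C \<Longrightarrow> u \<le> q" using u_le by (simp add: le_fun_def)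
  ultimately show thesis by (rule that)
qed

lemma Hahn_Banach_sublinear:
  fixes p :: "'v::real_vector \<Rightarrow> real"
  assumes "sublinear p"
  obtains L where "linear L" "\<And>x. L x \<le> p x" "L x0 = p x0"
proof -
  \<comment> \<open>Reducing at \<open>x0\<close> before Zorn's lemma settles the normalization: a
    linear \<open>L\<close> below \<open>p0\<close> has
    \<open>- L x0 = L (- x0) \<le> - p x0\<close>, hence \<open>L x0 \<ge> p x0\<close>.\<close>
  obtain p0 where p0: "sublinear p0" "p0 \<le> p" "p0 (- x0) \<le> - p x0"
    using sublinear_reduce[OF assms] .
  define A where "A = {q. sublinear q \<and> q \<le> p0}"
  have "\<exists>m\<in>A. \<forall>a\<in>A. m \<ge> a \<longrightarrow> a = m"
  proof (rule predicate_Zorn)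
    show "partial_order_on A (relation_of (\<ge>) A)"
      by (rule partial_order_on_relation_ofI) auto
  next
    fix C assume "C \<in> Chains (relation_of (\<ge>) A)"
    then have CA: "C \<subseteq> A" and chain: "\<And>q r. q \<in> C \<Longrightarrow> r \<in> C \<Longrightarrow> q \<le> r \<or> r \<le> q"
      by (auto simp: Chains_def relation_of_def)
    show "\<exists>u\<in>A. \<forall>a\<in>C. a \<ge> u"
    proof (cases "C = {}")
      case True
      then show ?thesis using p0 by (auto simp: A_def)
    next
      case False
      obtain u where u: "sublinear u" "\<And>q. q \<in> C \<Longrightarrow> u \<le> q"
        using sublinear_INF_chain[OF False _ chain, of p0] CA unfolding A_def by blast
      moreover have "u \<le> p0" using False u(2) CA unfolding A_def by (blast intro: order_trans)
      ultimately show ?thesis by (auto simp: A_def)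
    qed
  qed
  then obtain L where L: "sublinear L" "L \<le> p0"
    and min: "\<And>q. sublinear q \<Longrightarrow> q \<le> L \<Longrightarrow> q = L"
    unfolding A_def using order_trans by (smt (verit, best) mem_Collect_eq)
  have minus: "L (- y) = - L y" for y
  proof -
    obtain q where "sublinear q" "q \<le> L" "q (- y) \<le> - L y" using sublinear_reduce[OF L(1)] .
    with min have "L (- y) \<le> - L y" by blast
    with sublinear_minus[OF L(1), of y] show ?thesis by simp
  qed
  have add: "L (x + y) = L x + L y" for x y
    using sublinear_add[OF L(1), of "x + y" "- y"] sublinear_add[OF L(1), of x y] minus[of y]
    by simp
  have scale: "L (c *\<^sub>R x) = c * L x" for c x
  proof (cases "c \<ge> 0")
    case True
    then show ?thesis by (rule sublinear_scale[OF L(1)])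
  next
    case False
    then show ?thesis using sublinear_scale[OF L(1), of "- c" x] minus[of "c *\<^sub>R x"] by simp
  qed
  have "linear L" using add scale by (intro linearI) auto
  moreover have le: "L x \<le> p x" for x using L(2) p0(2) by (meson le_funD order_trans)
  moreover have "L x0 = p x0"
    using le_funD[OF L(2), of "- x0"] p0(3) minus[of x0] le[of x0] by simp
  ultimately show thesis by (rule that)
qed

section \<open>Radon measures on completely regular spaces\<close>

text \<open>The sets containing both or neither of \<open>x\<close> and \<open>y\<close> form a
  sigma-algebra, and by hypothesis it contains the open sets.\<close>

lemma borel_indistinguishable:
  assumes "B \<in> sets borel" and "\<And>U. open U \<Longrightarrow> x \<in> U \<longleftrightarrow> y \<in> U"
  shows "x \<in> B \<longleftrightarrow> y \<in> B"
proof -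
  have "B \<in> sigma_sets UNIV {S. open S}" using assms(1) by (simp add: borel_def)
  then show ?thesis by induction (use assms(2) in auto)
qed

lemma regular_separate_compact_closed:
  assumes "regular_space (euclidean :: 'a::topological_space topology)"
    and "compact K" "closed (C :: 'a set)" "K \<inter> C = {}"
  obtains U V where "open U" "open V" "K \<subseteq> U" "C \<subseteq> V" "U \<inter> V = {}"
  using regular_space_compact_closed_separation[OF assms(1), of K C] assms
  by (auto simp: disjnt_def)

text \<open>Without a Hausdorff axiom compact sets need not be closed, but Borel sets cannot split
  topologically indistinguishable points, and compact sets with that property are closed.\<close>

lemma compact_borel_imp_closed:
  assumes reg: "regular_space (euclidean :: 'a::topological_space topology)"
    and K: "compact (K :: 'a set)" "K \<in> sets borel"
  shows "closed K"
proof -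
  have "\<exists>V. open V \<and> x \<in> V \<and> V \<subseteq> - K" if x: "x \<notin> K" for x
  proof -
    have "y \<notin> closure {x}" if y: "y \<in> K" for y
    proof
      assume cl: "y \<in> closure {x}"
      \<comment> \<open>Regularity makes the relation \<open>y \<in> closure {x}\<close> symmetric:
        a point \<open>x\<close> of an open \<open>U\<close> can be separated from
        \<open>- U\<close>, which keeps its whole closure inside \<open>U\<close>.\<close>
      have "x \<in> U \<longleftrightarrow> y \<in> U" if U: "open U" for U
      proof
        assume "y \<in> U"
        with cl U show "x \<in> U" by (auto simp: closure_iff_nhds_not_empty)
      next
        assume "x \<in> U"
        then obtain V W where VW: "open V" "open W" "x \<in> V" "- U \<subseteq> W" "V \<inter> W = {}"
          using regular_separate_compact_closed[OF reg, of "{x}" "- U"] U by auto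
        have "closure {x} \<subseteq> - W" using VW by (intro closure_minimal) auto
        with cl VW show "y \<in> U" by auto
      qed
      with borel_indistinguishable[OF K(2), of x y] x y show False by blast
    qed
    then have "K \<inter> closure {x} = {}" by auto
    then obtain U V where "open U" "open V" "K \<subseteq> U" "closure {x} \<subseteq> V" "U \<inter> V = {}"
      by (rule regular_separate_compact_closed[OF reg K(1) closed_closure])
    moreover have "x \<in> closure {x}" using closure_subset by blast
    ultimately show ?thesis by (intro exI[of _ V]) auto
  qed
  then have "open (- K)" by (subst open_subopen) auto
  then show ?thesis by (simp add: closed_def)
qed

text \<open>Finitely many open sets covering \<open>K\<close> already cover its closure, because
  regularity separates \<open>K\<close> from the closed complement of their union. This later
  provides compact sets that are also closed.\<close>

lemma regular_compact_closure:
  assumes reg: "regular_space (euclidean :: 'a::topological_space topology)"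
    and K: "compact (K :: 'a set)"
  shows "compact (closure K)"
proof (rule compactI)
  fix \<C> :: "'a set set" assume op: "\<forall>t\<in>\<C>. open t" and cov: "closure K \<subseteq> \<Union>\<C>"
  have "K \<subseteq> \<Union>\<C>" using cov closure_subset by blast
  with op obtain D where D: "D \<subseteq> \<C>" "finite D" "K \<subseteq> \<Union>D"
    using compactE[OF K, of \<C>] by metis
  have "closed (- \<Union>D)" using D op by (auto intro!: open_Union)
  moreover have "K \<inter> - \<Union>D = {}" using D(3) by blast
  ultimately obtain U V where UV: "open U" "open V" "K \<subseteq> U" "- \<Union>D \<subseteq> V" "U \<inter> V = {}"
    by (rule regular_separate_compact_closed[OF reg K])
  have "closure K \<subseteq> - V" using UV by (intro closure_minimal) auto
  with UV(4) have "closure K \<subseteq> \<Union>D" by auto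
  with D(1,2) show "\<exists>C'\<subseteq>\<C>. finite C' \<and> closure K \<subseteq> \<Union>C'" by (intro exI[of _ D]) simp
qed

section \<open>Bounded continuous functions: closure properties, integrability, separation\<close>

lemma scaled_bcontfun: "f \<in> bcontfun \<Longrightarrow> (\<lambda>x. c * f x :: real) \<in> bcontfun"
  using scaleR_cont[of f c] by simp

lemma max_bcontfun:
  fixes f g :: "'a::topological_space \<Rightarrow> real"
  assumes "f \<in> bcontfun" "g \<in> bcontfun"
  shows "(\<lambda>x. max (f x) (g x)) \<in> bcontfun"
proof -
  obtain a b where "\<forall>x. \<bar>f x\<bar> \<le> a" "\<forall>x. \<bar>g x\<bar> \<le> b"
    using assms by (auto simp: bcontfun_def bounded_iff)
  then have "norm (max (f x) (g x)) \<le> max a b" for x by (auto simp: max_def abs_le_iff intro: order_trans)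
  then show ?thesis
    using assms by (intro bcontfun_normI[of _ "max a b"] continuous_on_max) (auto simp: bcontfun_def)
qed

lemma min_bcontfun:
  fixes f g :: "'a::topological_space \<Rightarrow> real"
  assumes "f \<in> bcontfun" "g \<in> bcontfun"
  shows "(\<lambda>x. min (f x) (g x)) \<in> bcontfun"
proof -
  have "(\<lambda>x. - max (- f x) (- g x)) \<in> bcontfun"
    by (intro uminus_cont max_bcontfun assms)
  then show ?thesis by (simp add: minus_max_eq_min)
qed

lemma sum_bcontfun:
  fixes f :: "'i \<Rightarrow> 'a::topological_space \<Rightarrow> real"
  assumes "\<And>i. i \<in> I \<Longrightarrow> f i \<in> bcontfun"
  shows "(\<lambda>x. \<Sum>i\<in>I. f i x) \<in> bcontfun"
  using assms by (induction I rule: infinite_finite_induct) (auto intro: const_bcontfun plus_cont)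

lemma compose_bcontfun:
  assumes "f \<in> bcontfun" "continuous_on UNIV g"
  shows "(\<lambda>x. f (g x)) \<in> bcontfun"
  using assms unfolding bcontfun_def
  by (auto intro: continuous_on_compose2[of UNIV f] bounded_subset)

lemmas bcontfun_intros =
  const_bcontfun plus_cont minus_cont uminus_cont scaled_bcontfun max_bcontfun min_bcontfun
  sum_bcontfun

lemma bcontfun_borel_measurable:
  fixes f :: "'a::topological_space \<Rightarrow> real"
  shows "f \<in> bcontfun \<Longrightarrow> f \<in> borel_measurable borel"
  by (intro borel_measurable_continuous_onI) (simp add: bcontfun_def)

lemma integrable_bounded_borel:
  fixes f :: "'a::topological_space \<Rightarrow> real"
  assumes "finite_measure M" "sets M = sets borel" "f \<in> borel_measurable borel" "bounded (range f)"
  shows "integrable M f"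
proof -
  obtain b where "\<forall>x. \<bar>f x\<bar> \<le> b" using assms(4) by (auto simp: bounded_iff)
  then show ?thesis
    using assms(3) measurable_cong_sets[OF assms(2) refl, of borel]
    by (intro finite_measure.integrable_const_bound[OF assms(1), of _ b]) auto
qed

lemma integrable_bcontfun:
  fixes f :: "'a::topological_space \<Rightarrow> real"
  assumes "finite_measure M" "sets M = sets borel" "f \<in> bcontfun"
  shows "integrable M f"
  using assms bcontfun_borel_measurable[OF assms(3)]
  by (intro integrable_bounded_borel) (auto simp: bcontfun_def)

lemma integrable_bcontfun_compose:
  fixes f :: "'a::topological_space \<Rightarrow> real"
  assumes "finite_measure M" "sets M = sets borel" "f \<in> bcontfun" "continuous_on UNIV p"
  shows "integrable M (\<lambda>z. f (p z))"
  using integrable_bcontfun[OF assms(1,2) compose_bcontfun[OF assms(3,4)]] .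

lemma bcontfun_separate:
  fixes K U :: "'a::topological_space set"
  assumes "completely_regular_space (euclidean :: 'a topology)"
    and "compact K" "open U" "K \<subseteq> U"
  obtains w :: "'a \<Rightarrow> real" where "w \<in> bcontfun" "\<And>x. 0 \<le> w x" "\<And>x. w x \<le> 1"
    "\<And>x. x \<in> K \<Longrightarrow> w x = 1" "\<And>x. x \<notin> U \<Longrightarrow> w x = 0"
proof -
  have "disjnt K (- U)" using assms by (auto simp: disjnt_def)
  then obtain f where f: "continuous_map euclidean (subtopology euclidean {0..1::real}) f"
    "f ` (- U) \<subseteq> {0}" "f ` K \<subseteq> {1}"
    using Urysohn_completely_regular_compact_closed[of 0 1, OF _ assms(1), of K "- U"] assms
    by auto
  then have c: "continuous_on UNIV f" and r: "0 \<le> f x" "f x \<le> 1" for x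
    by (auto simp: continuous_map_in_subtopology image_subset_iff Pi_iff)
  then have "f \<in> bcontfun" by (intro bcontfun_normI[of _ 1]) auto
  with r f show thesis by (intro that[of f]) auto
qed

section \<open>Regularity and comparison of measures by test functions\<close>

lemma radon_measuresD:
  assumes "M \<in> radon_measures"
  shows "sets M = sets borel" "finite_measure M" "space M = UNIV"
    and "B \<in> sets borel \<Longrightarrow> e > 0 \<Longrightarrow>
      \<exists>K. compact K \<and> K \<in> sets borel \<and> K \<subseteq> B \<and> measure M (B - K) < e"
  using assms sets_eq_imp_space_eq[of M borel] by (auto simp: radon_measures_def)

text \<open>Inner regularity applied to \<open>- B\<close>: the compact Borel set found there is
  closed by \<open>compact_borel_imp_closed\<close>, so its complement is the required open
  set.\<close>

lemma radon_outer_regular: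
  assumes "regular_space (euclidean :: 'a::topological_space topology)"
    and M: "(M :: 'a measure) \<in> radon_measures" and B: "B \<in> sets borel" and "e > 0"
  obtains U where "open U" "B \<subseteq> U" "measure M U < measure M B + e"
proof -
  interpret finite_measure M using radon_measuresD[OF M] by blast
  have [simp]: "sets M = sets borel" "space M = UNIV" using radon_measuresD[OF M] by auto
  have "- B \<in> sets borel" using B by auto
  then obtain K where K: "compact K" "K \<in> sets borel" "K \<subseteq> - B" "measure M (- B - K) < e"
    using radon_measuresD(4)[OF M, of "- B" e] \<open>e > 0\<close> by blast
  have "closed K" using compact_borel_imp_closed assms(1) K by blast
  have "measure M (- K) = measure M B + measure M (- B - K)"
    using K B by (subst finite_measure_Union[symmetric]) (auto intro!: arg_cong[where f = "measure M"])
  with K \<open>closed K\<close> show thesis by (intro that[of "- K"]) auto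
qed

lemma continuous_borel_measurable:
  assumes "sets M = sets borel" "continuous_on UNIV p"
  shows "p \<in> measurable M borel"
  using borel_measurable_continuous_onI[OF assms(2)] measurable_cong_sets[OF assms(1) refl] by blast

text \<open>If \<open>K\<close> nearly fills \<open>p -\<close> U\<open>, then\<close>p
  \<open>K\<close> is a compact subset of \<open>U\<close>, and a Urysohn function for this pair
  differs from the indicator, along \<open>p\<close>, only off \<open>K\<close>. Keeping
  \<open>p\<close> explicit uses the Radon property of \<open>M\<close> itself instead of that of
  its image.\<close>

lemma radon_open_approximation:
  fixes p :: "'z::topological_space \<Rightarrow> 'a::topological_space"
  assumes cr: "completely_regular_space (euclidean :: 'a topology)"
    and M: "M \<in> radon_measures" and p: "continuous_on UNIV p" and U: "open U" and e: "e > 0"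
  obtains w :: "'a \<Rightarrow> real" where "w \<in> bcontfun" "\<And>x. 0 \<le> w x" "\<And>x. w x \<le> indicator U x"
    "(\<integral>z. indicator U (p z) - w (p z) \<partial>M) < e"
proof -
  interpret finite_measure M using radon_measuresD[OF M] by blast
  have [simp]: "sets M = sets borel" "space M = UNIV" using radon_measuresD[OF M] by auto
  have pU: "p -` U \<in> sets borel" using p U by (simp add: open_vimage)
  then obtain K where K: "compact K" "K \<in> sets borel" "K \<subseteq> p -` U" "measure M (p -` U - K) < e"
    using radon_measuresD(4)[OF M, of "p -` U" e] e by blast
  have "compact (p ` K)"
    using K p by (meson compact_continuous_image continuous_on_subset top_greatest)
  moreover have "p ` K \<subseteq> U" using K by auto
  ultimately obtain w :: "'a \<Rightarrow> real" where w: "w \<in> bcontfun" "\<And>x. 0 \<le> w x" "\<And>x. w x \<le> 1"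
    "\<And>x. x \<in> p ` K \<Longrightarrow> w x = 1" "\<And>x. x \<notin> U \<Longrightarrow> w x = 0"
    using bcontfun_separate[OF cr _ U] by metis
  have i: "integrable M (indicator A :: 'z \<Rightarrow> real)" if "A \<in> sets borel" for A
    using that by (auto intro!: integrable_real_indicator simp: emeasure_eq_measure)
  have "(\<integral>z. indicator U (p z) - w (p z) \<partial>M) \<le> (\<integral>z. indicator (p -` U - K) z \<partial>M)"
  proof (rule integral_mono)
    show "integrable M (\<lambda>z. indicator U (p z) - w (p z))"
      using Bochner_Integration.integrable_diff[OF i[OF pU]
          integrable_bcontfun_compose[OF finite_measure_axioms _ w(1) p]]
      by (simp add: indicator_vimage)
    show "integrable M (indicator (p -` U - K) :: 'z \<Rightarrow> real)" using pU K by (intro i) auto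
    show "indicator U (p z) - w (p z) \<le> indicator (p -` U - K) z" for z
      using w by (auto simp: indicator_def)
  qed
  also have "\<dots> = measure M (p -` U - K)" using pU K by simp
  finally have "(\<integral>z. indicator U (p z) - w (p z) \<partial>M) < e" using K by simp
  moreover have "w x \<le> indicator U x" for x using w(3,5) by (auto simp: indicator_def)
  ultimately show thesis using that w by blast
qed

text \<open>Only the mass of \<open>M\<close> is approximated from inside, so \<open>N\<close> may
  be any finite Borel measure; in \<open>distr_eqI_bcontfun\<close> it is an image measure.\<close>

lemma measure_vimage_open_le:
  fixes p :: "'z::topological_space \<Rightarrow> 'a::topological_space"
  assumes cr: "completely_regular_space (euclidean :: 'a topology)"
    and M: "M \<in> radon_measures" and p: "continuous_on UNIV p"
    and N: "finite_measure N" "sets N = sets borel"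
    and le: "\<And>w :: 'a \<Rightarrow> real. w \<in> bcontfun \<Longrightarrow> (\<And>x. 0 \<le> w x) \<Longrightarrow> (\<And>x. w x \<le> 1) \<Longrightarrow>
      (\<integral>z. w (p z) \<partial>M) \<le> (\<integral>x. w x \<partial>N)"
    and U: "open U"
  shows "measure M (p -` U) \<le> measure N U"
proof (rule field_le_epsilon)
  fix e :: real assume "e > 0"
  interpret M: finite_measure M using radon_measuresD[OF M] by blast
  interpret N: finite_measure N by fact
  have [simp]: "sets M = sets borel" "space M = UNIV" using radon_measuresD[OF M] by auto
  have [simp]: "sets N = sets borel" "space N = UNIV" using N sets_eq_imp_space_eq[of N borel] by auto
  obtain w :: "'a \<Rightarrow> real" where w: "w \<in> bcontfun" "\<And>x. 0 \<le> w x" "\<And>x. w x \<le> indicator U x"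
    "(\<integral>z. indicator U (p z) - w (p z) \<partial>M) < e"
    using radon_open_approximation[OF cr M p U \<open>e > 0\<close>] by metis
  have w1: "w x \<le> 1" for x using w(3)[of x] indicator_le_1[of U x] by (rule order_trans)
  have pU: "p -` U \<in> sets borel" using p U by (simp add: open_vimage)
  have i1: "integrable M (indicator (p -` U) :: 'z \<Rightarrow> real)"
    using pU by (auto intro!: integrable_real_indicator simp: M.emeasure_eq_measure)
  have i2: "integrable M (\<lambda>z. w (p z))"
    using w(1) p M.finite_measure_axioms by (intro integrable_bcontfun_compose) auto
  have i3: "integrable N (indicator U :: 'a \<Rightarrow> real)"
    using U by (auto intro!: integrable_real_indicator simp: N.emeasure_eq_measure)
  have "measure M (p -` U) = (\<integral>z. indicator (p -` U) z \<partial>M)" using pU by simp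
  also have "\<dots> = (\<integral>z. indicator (p -` U) z - w (p z) \<partial>M) + (\<integral>z. w (p z) \<partial>M)"
    using i1 i2 by simp
  also have "(\<integral>z. indicator (p -` U) z - w (p z) \<partial>M) \<le> e" using w(4) by (simp add: indicator_vimage)
  also have "(\<integral>z. w (p z) \<partial>M) \<le> (\<integral>x. w x \<partial>N)" using w w1 by (intro le)
  also have "\<dots> \<le> (\<integral>x. indicator U x \<partial>N)"
    using w(3) i3 integrable_bcontfun[OF N w(1)] by (intro integral_mono) auto
  also have "\<dots> = measure N U" using U by simp
  finally show "measure M (p -` U) \<le> measure N U + e" by simp
qed

text \<open>Domination on open sets does not pass to Borel sets by a generator argument. Outer
  regularity of \<open>N\<close> makes the transition: enclose \<open>B\<close> in an open set of
  nearly the same \<open>N\<close>-measure.\<close>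

lemma distr_le_radon:
  fixes p :: "'z::topological_space \<Rightarrow> 'a::topological_space"
  assumes cr: "completely_regular_space (euclidean :: 'a topology)"
    and M: "M \<in> radon_measures" and p: "continuous_on UNIV p" and N: "N \<in> radon_measures"
    and le: "\<And>w :: 'a \<Rightarrow> real. w \<in> bcontfun \<Longrightarrow> (\<And>x. 0 \<le> w x) \<Longrightarrow> (\<And>x. w x \<le> 1) \<Longrightarrow>
      (\<integral>z. w (p z) \<partial>M) \<le> (\<integral>x. w x \<partial>N)"
    and B: "B \<in> sets borel"
  shows "emeasure (distr M borel p) B \<le> emeasure N B"
proof -
  interpret M: finite_measure M using radon_measuresD[OF M] by blast
  interpret N: finite_measure N using radon_measuresD[OF N] by blast
  have [simp]: "sets M = sets borel" "space M = UNIV" using radon_measuresD[OF M] by auto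
  have "measure M (p -` B) \<le> measure N B"
  proof (rule field_le_epsilon)
    fix e :: real assume "e > 0"
    obtain U where U: "open U" "B \<subseteq> U" "measure N U < measure N B + e"
      using radon_outer_regular[OF completely_regular_imp_regular_space[OF cr] N B \<open>e > 0\<close>] .
    have "measure M (p -` B) \<le> measure M (p -` U)"
      using U p by (intro M.finite_measure_mono) (auto simp: open_vimage)
    also have "\<dots> \<le> measure N U"
      using U radon_measuresD[OF N] by (intro measure_vimage_open_le[OF cr M p] le) auto
    finally show "measure M (p -` B) \<le> measure N B + e" using U by simp
  qed
  then show ?thesis
    using p B by (simp add: emeasure_distr M.emeasure_eq_measure N.emeasure_eq_measure
        continuous_borel_measurable)
qed

text \<open>Unlike domination, equality of finite measures does extend from the open sets, an
  intersection-stable generator. On open sets it comes from two opposite applications of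
  \<open>measure_vimage_open_le\<close>.\<close>

lemma distr_eqI_bcontfun:
  fixes p q :: "'z::topological_space \<Rightarrow> 'a::topological_space"
  assumes cr: "completely_regular_space (euclidean :: 'a topology)"
    and M: "M \<in> radon_measures" and p: "continuous_on UNIV p" and q: "continuous_on UNIV q"
    and eq: "\<And>w :: 'a \<Rightarrow> real. w \<in> bcontfun \<Longrightarrow> (\<integral>z. w (p z) \<partial>M) = (\<integral>z. w (q z) \<partial>M)"
  shows "distr M borel p = distr M borel q"
proof -
  interpret M: finite_measure M using radon_measuresD[OF M] by blast
  have [simp]: "sets M = sets borel" "space M = UNIV" using radon_measuresD[OF M] by auto
  have le: "measure M (f -` U) \<le> measure M (g -` U)"
    if f: "continuous_on UNIV f" and g: "continuous_on UNIV g" and U: "open U"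
      and fg: "\<And>w :: 'a \<Rightarrow> real. w \<in> bcontfun \<Longrightarrow> (\<integral>z. w (f z) \<partial>M) = (\<integral>z. w (g z) \<partial>M)" for f g U
  proof -
    have gm: "g \<in> measurable M borel" using g by (intro continuous_borel_measurable) auto
    have "measure M (f -` U) \<le> measure (distr M borel g) U"
    proof (rule measure_vimage_open_le[OF cr M f _ _ _ U])
      show "finite_measure (distr M borel g)" using gm by (rule M.finite_measure_distr)
      fix w :: "'a \<Rightarrow> real" assume w: "w \<in> bcontfun"
      show "(\<integral>z. w (f z) \<partial>M) \<le> (\<integral>x. w x \<partial>distr M borel g)"
        using fg[OF w] bcontfun_borel_measurable[OF w] gm by (simp add: integral_distr)
    qed simp
    also have "\<dots> = measure M (g -` U)" using gm U by (simp add: measure_distr)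
    finally show ?thesis .
  qed
  show ?thesis
  proof (rule measure_eqI_generator_eq[where E = "{S. open S}" and \<Omega> = UNIV and A = "\<lambda>_. UNIV"])
    show "Int_stable {S :: 'a set. open S}" by (auto simp: Int_stable_def)
    fix U :: "'a set" assume "U \<in> {S. open S}"
    then have U: "open U" by simp
    have "measure M (p -` U) = measure M (q -` U)"
      using le[OF p q U] le[OF q p U] eq by (intro antisym) auto
    then show "emeasure (distr M borel p) U = emeasure (distr M borel q) U"
      using U p q by (simp add: emeasure_distr continuous_borel_measurable M.emeasure_eq_measure)
  next
    have pm: "p \<in> measurable M borel" using p by (intro continuous_borel_measurable) auto
    then show "emeasure (distr M borel p) UNIV \<noteq> \<infinity>" by (simp add: emeasure_distr M.emeasure_eq_measure)
  qed (simp_all add: borel_def)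
qed

section \<open>The Riesz representation of tight functionals\<close>

text \<open>Term \<open>k\<close> is the length of the part of [0, t] lying in [k, k + 1].\<close>

lemma sum_clamp:
  fixes t :: real
  assumes "t \<ge> 0"
  shows "(\<Sum>k<n. max 0 (min 1 (t - real k))) = min t (real n)"
  using assms by (induction n) (auto simp: min_def max_def)

lemma layer_cake_lower:
  fixes t :: real
  assumes "0 \<le> t" "t \<le> 1"
  shows "real n * t \<le> (\<Sum>k<n. of_bool (real n * t > real k))"
proof -
  have "real n * t = (\<Sum>k<n. max 0 (min 1 (real n * t - real k)))"
    using assms by (subst sum_clamp) (auto simp: min_def mult_left_le)
  also have "\<dots> \<le> (\<Sum>k<n. of_bool (real n * t > real k))"
    by (intro sum_mono) auto
  finally show ?thesis .
qed

lemma layer_cake_upper: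
  fixes t :: real
  assumes "0 \<le> t"
  shows "(\<Sum>k<n. of_bool (real n * t > real k)) \<le> real n * t + 1"
proof -
  \<comment> \<open>Raising the height by 1 completes the topmost slice:
    \<open>real n * t > real k\<close> makes slice \<open>k\<close> of \<open>real n * t + 1\<close>
    full.\<close>
  have "(\<Sum>k<n. of_bool (real n * t > real k)) \<le> (\<Sum>k<n. max 0 (min 1 (real n * t + 1 - real k)))"
    by (intro sum_mono) auto
  also have "\<dots> \<le> real n * t + 1"
    using assms by (subst sum_clamp) auto
  finally show ?thesis .
qed

text \<open>The condition \<open>tight\<close> is what yields countable additivity without
  compactness of the space. Closedness of \<open>K\<close> is requested separately since compact
  sets need not be closed here, while the proofs need \<open>- K\<close> open.\<close>

locale tight_functional =
  fixes L :: "('z::topological_space \<Rightarrow> real) \<Rightarrow> real"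
  assumes cr: "completely_regular_space (euclidean :: 'z topology)"
    and add: "f \<in> bcontfun \<Longrightarrow> g \<in> bcontfun \<Longrightarrow> L (\<lambda>z. f z + g z) = L f + L g"
    and scale: "f \<in> bcontfun \<Longrightarrow> L (\<lambda>z. c * f z) = c * L f"
    and pos: "f \<in> bcontfun \<Longrightarrow> (\<And>z. 0 \<le> f z) \<Longrightarrow> 0 \<le> L f"
    and tight: "e > 0 \<Longrightarrow> \<exists>K. compact K \<and> closed K \<and>
      (\<forall>f\<in>bcontfun. (\<forall>z. 0 \<le> f z \<and> f z \<le> 1) \<longrightarrow> (\<forall>z\<in>K. f z = 0) \<longrightarrow> L f \<le> e)"
begin

lemma diff:
  assumes "f \<in> bcontfun" "g \<in> bcontfun"
  shows "L (\<lambda>z. f z - g z) = L f - L g"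
  using add[OF assms(1) scaled_bcontfun[OF assms(2), of "- 1"]] scale[OF assms(2), of "- 1"] by simp

lemma mono:
  assumes "f \<in> bcontfun" "g \<in> bcontfun" "\<And>z. f z \<le> g z"
  shows "L f \<le> L g"
proof -
  have "0 \<le> L (\<lambda>z. g z - f z)"
    using assms by (intro pos bcontfun_intros) auto
  also have "\<dots> = L g - L f" using assms by (simp add: diff)
  finally show ?thesis by simp
qed

lemma sum:
  assumes "finite I" "\<And>i. i \<in> I \<Longrightarrow> f i \<in> bcontfun"
  shows "L (\<lambda>z. \<Sum>i\<in>I. f i z) = (\<Sum>i\<in>I. L (f i))"
  using assms
proof (induction I rule: finite_induct)
  case empty
  show ?case using scale[of "\<lambda>_. 0" 0] by (simp add: const_bcontfun)
next
  case (insert i I)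
  then show ?case by (simp add: add sum_bcontfun)
qed

lemma const: "L (\<lambda>_. c) = c * L (\<lambda>_. 1)"
  using scale[of "\<lambda>_. 1" c] by (simp add: const_bcontfun)

section \<open>The Riesz outer measure: \<open>rho\<close> on open sets, \<open>mu\<close> on all
  sets\<close>

definition subordinate :: "'z set \<Rightarrow> ('z \<Rightarrow> real) set" where
  "subordinate U = {f \<in> bcontfun. \<forall>z. 0 \<le> f z \<and> f z \<le> indicator U z}"

definition rho :: "'z set \<Rightarrow> real" where
  "rho U = (SUP f\<in>subordinate U. L f)"

definition mu :: "'z set \<Rightarrow> real" where
  "mu A = (INF U\<in>{U. open U \<and> A \<subseteq> U}. rho U)"

lemma subordinate_le_1: "f \<in> subordinate U \<Longrightarrow> f z \<le> 1"
  unfolding subordinate_def using indicator_le_1[of U z] by (auto intro: order_trans)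

lemma subordinate_bcontfun: "f \<in> subordinate U \<Longrightarrow> f \<in> bcontfun"
  and subordinate_nonneg: "f \<in> subordinate U \<Longrightarrow> 0 \<le> f z"
  by (auto simp: subordinate_def)

lemma subordinate_outside: "f \<in> subordinate U \<Longrightarrow> z \<notin> U \<Longrightarrow> f z = 0"
  by (auto simp: subordinate_def indicator_def intro!: antisym split: if_splits dest: spec[of _ z])

lemma zero_subordinate: "(\<lambda>_. 0) \<in> subordinate U"
  by (simp add: subordinate_def const_bcontfun)

lemma L_subordinate_le: "f \<in> subordinate U \<Longrightarrow> L f \<le> L (\<lambda>_. 1)"
  using subordinate_le_1 by (intro mono) (auto simp: subordinate_def const_bcontfun)

lemma rho_upper: "f \<in> subordinate U \<Longrightarrow> L f \<le> rho U"
  unfolding rho_def using L_subordinate_le by (intro cSUP_upper bdd_aboveI2) auto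

lemma rho_least: "(\<And>f. f \<in> subordinate U \<Longrightarrow> L f \<le> c) \<Longrightarrow> rho U \<le> c"
  unfolding rho_def using zero_subordinate by (intro cSUP_least) auto

lemma rho_nonneg: "0 \<le> rho U"
  using rho_upper[OF zero_subordinate] const[of 0] by simp

lemma rho_le_total: "rho U \<le> L (\<lambda>_. 1)"
  by (intro rho_least L_subordinate_le)

lemma rho_mono: "U \<subseteq> V \<Longrightarrow> rho U \<le> rho V"
proof (intro rho_least rho_upper)
  fix f assume "U \<subseteq> V" and f: "f \<in> subordinate U"
  then have "f z \<le> indicator V z" for z
    using subordinate_le_1[OF f, of z] subordinate_outside[OF f, of z]
    by (cases "z \<in> U") (auto simp: indicator_def)
  with f show "f \<in> subordinate V" by (simp add: subordinate_def)
qed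

lemma rho_UNIV: "rho UNIV = L (\<lambda>_. 1)"
  using rho_upper[of "\<lambda>_. 1" UNIV] rho_le_total[of UNIV]
  by (simp add: subordinate_def const_bcontfun)

lemma rho_empty: "rho {} = 0"
proof (rule antisym)
  show "rho {} \<le> 0"
  proof (rule rho_least)
    fix f assume "f \<in> subordinate {}"
    then have "f = (\<lambda>_. 0)" using subordinate_outside[of f "{}"] by auto
    then show "L f \<le> 0" using const[of 0] by simp
  qed
qed (rule rho_nonneg)

lemma mu_lower: "open U \<Longrightarrow> A \<subseteq> U \<Longrightarrow> mu A \<le> rho U"
  unfolding mu_def using rho_nonneg by (intro cINF_lower bdd_belowI2) auto

lemma mu_greatest: "(\<And>U. open U \<Longrightarrow> A \<subseteq> U \<Longrightarrow> c \<le> rho U) \<Longrightarrow> c \<le> mu A"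
  unfolding mu_def by (intro cINF_greatest) (auto intro: exI[of _ UNIV])

lemma mu_nonneg: "0 \<le> mu A"
  by (intro mu_greatest rho_nonneg)

lemma mu_open: "open U \<Longrightarrow> mu U = rho U"
  by (intro antisym mu_lower mu_greatest rho_mono) auto

lemma mu_mono: "A \<subseteq> B \<Longrightarrow> mu A \<le> mu B"
  by (intro mu_greatest mu_lower) auto

lemma mu_outer:
  assumes "e > 0"
  shows "\<exists>U. open U \<and> A \<subseteq> U \<and> rho U < mu A + e"
proof -
  have "\<not> mu A + e \<le> mu A" using assms by simp
  then show ?thesis using mu_greatest[of A "mu A + e"] by (meson not_le)
qed

section \<open>Countable subadditivity and the Caratheodory inequality\<close>

text \<open>By tightness only a compact part of \<open>{f \<ge> \<delta>}\<close> matters; it is covered by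
  finitely many of the \<open>U i\<close>, and \<open>f\<close> is dominated there by functions subordinate to these.\<close>

lemma subordinate_Union_le:
  assumes U: "\<And>i :: nat. open (U i)" and f: "f \<in> subordinate (\<Union>i. U i)" and "e > 0"
  obtains n where "L f \<le> (\<Sum>i<n. rho (U i)) + e"
proof -
  \<comment> \<open>Two errors have to fit into \<open>e\<close>: cutting \<open>f\<close> at level
    \<open>\<delta>\<close> costs \<open>\<delta> * L (\<lambda>_. 1)\<close>, and the part off the
    tightness set costs \<open>\<delta>\<close>.\<close>
  define \<delta> where "\<delta> = e / (L (\<lambda>_. 1) + 1)"
  have L1: "0 \<le> L (\<lambda>_. 1)" by (intro pos const_bcontfun) auto
  have \<delta>: "\<delta> > 0" using L1 \<open>e > 0\<close> by (simp add: \<delta>_def)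
  have "\<delta> * (L (\<lambda>_. 1) + 1) = e" using L1 by (simp add: \<delta>_def)
  then have \<delta>e: "\<delta> * L (\<lambda>_. 1) + \<delta> = e" by (simp add: algebra_simps)
  have fb: "f \<in> bcontfun" and f0: "0 \<le> f z" and f1: "f z \<le> 1" for z
    using f subordinate_bcontfun subordinate_nonneg subordinate_le_1 by auto
  obtain K where K: "compact K" "closed K" and
    KL: "\<And>f. f \<in> bcontfun \<Longrightarrow> \<forall>z. 0 \<le> f z \<and> f z \<le> 1 \<Longrightarrow> \<forall>z\<in>K. f z = 0 \<Longrightarrow> L f \<le> \<delta>"
    using tight[OF \<delta>] by blast
  define K' where "K' = K \<inter> {z. \<delta> \<le> f z}"
  have "closed {z. \<delta> \<le> f z}"
    using fb by (intro closed_Collect_le continuous_intros) (auto simp: bcontfun_def)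
  then have K': "compact K'" unfolding K'_def using K by (intro compact_Int_closed)
  have "\<exists>i w. w \<in> subordinate (U i) \<and> w z = 1" if z: "z \<in> K'" for z
  proof -
    have "f z > 0" using z \<delta> by (auto simp: K'_def)
    then have "z \<in> (\<Union>i. U i)" using subordinate_outside[OF f, of z] by force
    then obtain i where i: "z \<in> U i" by blast
    obtain w :: "'z \<Rightarrow> real" where w: "w \<in> bcontfun" "\<And>x. 0 \<le> w x" "\<And>x. w x \<le> 1"
      "\<And>x. x \<in> {z} \<Longrightarrow> w x = 1" "\<And>x. x \<notin> U i \<Longrightarrow> w x = 0"
      using bcontfun_separate[OF cr, of "{z}" "U i"] U i by auto
    then have "w \<in> subordinate (U i)" by (auto simp: subordinate_def indicator_def)
    with w(4)[of z] show ?thesis by blast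
  qed
  then obtain i w where iw: "\<And>z. z \<in> K' \<Longrightarrow> w z \<in> subordinate (U (i z))"
    "\<And>z. z \<in> K' \<Longrightarrow> w z z = (1 :: real)" by metis
  have "open {x. 1/2 < w z x}" if "z \<in> K'" for z
    using subordinate_bcontfun[OF iw(1)[OF that]]
    by (intro open_Collect_less continuous_intros) (auto simp: bcontfun_def)
  then obtain D where D: "D \<subseteq> K'" "finite D" "K' \<subseteq> (\<Union>z\<in>D. {x. 1/2 < w z x})"
  proof (rule compactE_image[OF K'])
    show "K' \<subseteq> (\<Union>z\<in>K'. {x. 1/2 < w z x})" using iw(2) by force
  qed
  \<comment> \<open>The bumps are grouped by the open set they belong to. The factor 2 undoes the
    threshold 1/2 of the cover, so some \<open>h j\<close> reaches 1 at each point of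
    \<open>K'\<close>; truncation at 1 keeps \<open>h j\<close> subordinate to
    \<open>U j\<close>.\<close>
  define S where "S j x = (\<Sum>z\<in>{z\<in>D. i z = j}. 2 * w z x)" for j x
  define h where "h j x = min 1 (S j x)" for j x
  have w0: "0 \<le> w z x" if "z \<in> D" for z x
    using subordinate_nonneg[OF iw(1)] D(1) that by auto
  have wb: "w z \<in> bcontfun" if "z \<in> D" for z
    using subordinate_bcontfun[OF iw(1)] D(1) that by auto
  have hb: "h j \<in> bcontfun" for j
    unfolding h_def S_def using wb by (intro bcontfun_intros) auto
  have h0: "0 \<le> h j x" for j x
    unfolding h_def S_def using w0 by (auto intro!: sum_nonneg)
  have hU: "h j \<in> subordinate (U j)" for j
  proof -
    have "h j x \<le> 0" if x: "x \<notin> U j" for x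
    proof -
      have "w z x = 0" if "z \<in> {z\<in>D. i z = j}" for z
        using iw(1)[of z] that D(1) x subordinate_outside[of "w z" "U j" x] by auto
      then have "S j x = 0" unfolding S_def by (intro sum.neutral) auto
      then show ?thesis by (simp add: h_def)
    qed
    moreover have "h j x \<le> 1" for x by (simp add: h_def)
    ultimately show ?thesis using hb h0 by (auto simp: subordinate_def indicator_def)
  qed
  obtain n where n: "\<And>z. z \<in> D \<Longrightarrow> i z < n"
    using finite_nat_set_iff_bounded[of "i ` D"] D(2) by auto
  have cover: "1 \<le> (\<Sum>j<n. h j x)" if x: "x \<in> K'" for x
  proof -
    obtain z where z: "z \<in> D" "1/2 < w z x" using D(3) x by auto
    have "2 * w z x \<le> S (i z) x"
      unfolding S_def using z D(2) w0 by (intro member_le_sum) auto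
    with z have "1 \<le> h (i z) x" by (simp add: h_def)
    also have "\<dots> \<le> (\<Sum>j<n. h j x)" using n[OF z(1)] h0 by (intro member_le_sum) auto
    finally show ?thesis .
  qed
  \<comment> \<open>\<open>g\<close> is what the level \<open>\<delta>\<close> and the functions
    \<open>h j\<close> leave of \<open>f\<close>. It vanishes on \<open>K\<close>: on
    \<open>K'\<close> the \<open>h j\<close> sum to at least 1, and on the rest of \<open>K\<close>
    already \<open>f < \<delta>\<close>.\<close>
  define g where "g x = max 0 (f x - \<delta> - (\<Sum>j<n. h j x))" for x
  have gb: "g \<in> bcontfun"
    unfolding g_def using fb hb by (intro bcontfun_intros) auto
  have sum0: "0 \<le> (\<Sum>j<n. h j x)" for x by (intro sum_nonneg h0)
  have "L g \<le> \<delta>"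
  proof (intro KL gb allI ballI)
    show "0 \<le> g z \<and> g z \<le> 1" for z using f1[of z] \<delta> sum0[of z] by (auto simp: g_def)
    show "g z = 0" if "z \<in> K" for z
    proof (cases "\<delta> \<le> f z")
      case True
      with that have "1 \<le> (\<Sum>j<n. h j z)" by (intro cover) (simp add: K'_def)
      then show ?thesis using f1[of z] \<delta> by (auto simp: g_def)
    next
      case False
      then show ?thesis using sum0[of z] by (auto simp: g_def)
    qed
  qed
  have hs: "(\<lambda>x. \<Sum>j<n. h j x) \<in> bcontfun" using hb by (intro bcontfun_intros)
  have "L f \<le> L (\<lambda>x. (g x + \<delta>) + (\<Sum>j<n. h j x))"
    by (rule mono[OF fb plus_cont[OF plus_cont[OF gb const_bcontfun] hs]]) (simp add: g_def)
  also have "\<dots> = L g + \<delta> * L (\<lambda>_. 1) + (\<Sum>j<n. L (h j))"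
    using gb hb hs by (simp add: add plus_cont const_bcontfun sum const[of \<delta>])
  also have "(\<Sum>j<n. L (h j)) \<le> (\<Sum>j<n. rho (U j))" by (intro sum_mono rho_upper hU)
  finally show thesis using \<open>L g \<le> \<delta>\<close> \<delta>e by (intro that[of n]) simp
qed

lemma rho_Union_le:
  assumes U: "\<And>i :: nat. open (U i)"
  shows "ennreal (rho (\<Union>i. U i)) \<le> (\<Sum>i. ennreal (rho (U i)))"
proof (cases "(\<Sum>i. ennreal (rho (U i))) = top")
  case False
  then obtain r where r: "(\<Sum>i. ennreal (rho (U i))) = ennreal r" "r \<ge> 0"
    by (cases "\<Sum>i. ennreal (rho (U i))") auto
  have "rho (\<Union>i. U i) \<le> r"
  proof (rule rho_least, rule field_le_epsilon)
    fix f and e :: real assume f: "f \<in> subordinate (\<Union>i. U i)" and e: "e > 0"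
    obtain n where n: "L f \<le> (\<Sum>i<n. rho (U i)) + e"
      using subordinate_Union_le[OF U f e] .
    have "ennreal (\<Sum>i<n. rho (U i)) = (\<Sum>i<n. ennreal (rho (U i)))"
      using rho_nonneg by simp
    also have "\<dots> \<le> ennreal r" using r by (metis sum_le_suminf summableI finite_lessThan zero_le)
    finally have "(\<Sum>i<n. rho (U i)) \<le> r" using r by simp
    with n show "L f \<le> r + e" by simp
  qed
  then show ?thesis using r by (simp add: ennreal_leI)
qed simp

lemma mu_Union_le: "ennreal (mu (\<Union>i. A i)) \<le> (\<Sum>i :: nat. ennreal (mu (A i)))"
proof (rule ennreal_le_epsilon)
  fix e :: real assume e: "e > 0"
  have "\<exists>V. open V \<and> A i \<subseteq> V \<and> rho V < mu (A i) + e * (1/2) ^ Suc i" for i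
    using e by (intro mu_outer) simp
  then obtain U where U: "\<And>i. open (U i)" "\<And>i. A i \<subseteq> U i"
    "\<And>i. rho (U i) < mu (A i) + e * (1/2) ^ Suc i" by metis
  have "ennreal (mu (\<Union>i. A i)) \<le> ennreal (rho (\<Union>i. U i))"
    using U by (intro ennreal_leI mu_lower) auto
  also have "\<dots> \<le> (\<Sum>i. ennreal (rho (U i)))" using U(1) by (rule rho_Union_le)
  also have "\<dots> \<le> (\<Sum>i. ennreal (mu (A i)) + ennreal (e * (1/2) ^ Suc i))"
    using U(3) mu_nonneg e
    by (intro suminf_le) (auto simp: less_imp_le simp flip: ennreal_plus intro!: ennreal_leI)
  also have "\<dots> = (\<Sum>i. ennreal (mu (A i))) + (\<Sum>i. ennreal (e * (1/2) ^ Suc i))"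
    by (intro suminf_add[symmetric]) auto
  also have "(\<Sum>i. ennreal (e * (1/2) ^ Suc i)) = ennreal e"
  proof (rule suminf_ennreal_eq)
    show "(\<lambda>i. e * (1/2) ^ Suc i) sums e" using sums_mult[OF power_half_series, of e] by simp
  qed (use e in auto)
  finally show "ennreal (mu (\<Union>i. A i)) \<le> (\<Sum>i. ennreal (mu (A i))) + ennreal e" .
qed

text \<open>With \<open>f\<close> subordinate to \<open>V \<inter> U\<close>, any \<open>g\<close>
  subordinate to \<open>V \<inter> {z. f z < \<delta>}\<close> satisfies
  \<open>f + g \<le> 1 + \<delta>\<close> on \<open>V\<close> and vanishes with \<open>f\<close>
  outside. Dividing by \<open>1 + \<delta>\<close> gives a competitor for \<open>rho V\<close>, and
  the set used for \<open>g\<close> contains \<open>V - U\<close>.\<close>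

lemma rho_split_open:
  assumes U: "open U" and V: "open V"
  shows "rho (V \<inter> U) + mu (V - U) \<le> rho V"
proof -
  have "L f + mu (V - U) \<le> rho V" if f: "f \<in> subordinate (V \<inter> U)" for f
  proof (rule field_le_epsilon)
    fix e :: real assume e: "e > 0"
    define \<delta> where "\<delta> = e / (L (\<lambda>_. 1) + 1)"
    have L1: "0 \<le> L (\<lambda>_. 1)" by (intro pos const_bcontfun) auto
    have \<delta>: "\<delta> > 0" and \<delta>e: "\<delta> * L (\<lambda>_. 1) \<le> e"
      using L1 \<open>e > 0\<close> by (auto simp: \<delta>_def field_simps)
    have fb: "f \<in> bcontfun" and f0: "0 \<le> f z" for z
      using f subordinate_bcontfun subordinate_nonneg by auto
    define W where "W = V \<inter> {z. f z < \<delta>}"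
    have W: "open W"
      unfolding W_def using V fb by (intro open_Int open_Collect_less) (auto simp: bcontfun_def)
    have VUW: "V - U \<subseteq> W"
    proof
      fix z assume z: "z \<in> V - U"
      then have "f z = 0" using subordinate_outside[OF f] by blast
      with z \<delta> show "z \<in> W" by (auto simp: W_def)
    qed
    have "rho W \<le> rho V + \<delta> * L (\<lambda>_. 1) - L f"
    proof (rule rho_least)
      fix g assume g: "g \<in> subordinate W"
      have gb: "g \<in> bcontfun" and g0: "0 \<le> g z" for z
        using g subordinate_bcontfun subordinate_nonneg by auto
      have bnd: "f z + g z \<le> (1 + \<delta>) * indicator V z" for z
      proof (cases "z \<in> W")
        case True
        then show ?thesis using subordinate_le_1[OF g, of z] by (auto simp: W_def)
      next
        case False
        then have "g z = 0" using subordinate_outside[OF g] by blast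
        moreover have "f z \<le> indicator V z"
          using subordinate_le_1[OF f, of z] subordinate_outside[OF f, of z] by (auto simp: indicator_def)
        moreover have "indicator V z \<le> (1 + \<delta>) * indicator V z"
          using \<delta> by (auto simp: indicator_def)
        ultimately show ?thesis by linarith
      qed
      have "(\<lambda>z. (1 / (1 + \<delta>)) * (f z + g z)) \<in> bcontfun"
        using fb gb by (intro scaled_bcontfun plus_cont)
      moreover have "0 \<le> (1 / (1 + \<delta>)) * (f z + g z) \<and> (1 / (1 + \<delta>)) * (f z + g z) \<le> indicator V z" for z
        using f0[of z] g0[of z] bnd[of z] \<delta> by (simp add: field_simps)
      ultimately have "(\<lambda>z. (1 / (1 + \<delta>)) * (f z + g z)) \<in> subordinate V"
        by (simp only: subordinate_def mem_Collect_eq) blast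
      then have "L (\<lambda>z. (1 / (1 + \<delta>)) * (f z + g z)) \<le> rho V" by (rule rho_upper)
      then have "L f + L g \<le> (1 + \<delta>) * rho V"
        using fb gb \<delta> by (subst (asm) scale) (auto simp: add field_simps intro: plus_cont)
      also have "\<dots> \<le> rho V + \<delta> * L (\<lambda>_. 1)"
        using mult_left_mono[OF rho_le_total, of \<delta> V] \<delta> by (simp add: algebra_simps)
      finally show "L g \<le> rho V + \<delta> * L (\<lambda>_. 1) - L f" by simp
    qed
    with mu_lower[OF W VUW] \<delta>e show "L f + mu (V - U) \<le> rho V + e" by simp
  qed
  then have "rho (V \<inter> U) \<le> rho V - mu (V - U)" by (intro rho_least) (simp add: algebra_simps)
  then show ?thesis by simp
qed

section \<open>The representing measure and its integral\<close>

definition riesz_measure :: "'z measure" where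
  "riesz_measure = measure_of UNIV (sets borel) (\<lambda>A. ennreal (mu A))"

lemma sets_riesz_measure [simp]: "sets riesz_measure = sets borel"
  and space_riesz_measure [simp]: "space riesz_measure = UNIV"
  using sets.sigma_sets_eq[of borel] by (simp_all add: riesz_measure_def)

text \<open>\<open>measure_of\<close> returns the prescribed values once they are known to form a
  measure. The lambda system of the outer measure \<open>mu\<close> is a sigma-algebra on which
  \<open>mu\<close> is countably additive; \<open>rho_split_open\<close> puts the open sets, hence
  all Borel sets, into it.\<close>

lemma emeasure_riesz_measure:
  assumes "B \<in> sets borel"
  shows "emeasure riesz_measure B = ennreal (mu B)"
proof -
  let ?f = "\<lambda>A. ennreal (mu A)"
  interpret P: sigma_algebra UNIV "Pow (UNIV :: 'z set)" by (rule sigma_algebra_Pow)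
  have empty: "mu {} = 0" using mu_open[of "{}"] rho_empty by simp
  have outer: "outer_measure_space (Pow UNIV) ?f"
    using mu_mono mu_Union_le empty
    by (auto simp: outer_measure_space_def positive_def increasing_def countably_subadditive_def
        intro!: ennreal_leI)
  have Un: "mu (A \<union> B) \<le> mu A + mu B" for A B
  proof -
    have "ennreal (mu (\<Union>i. binaryset A B i)) \<le> (\<Sum>i. ennreal (mu (binaryset A B i)))"
      by (rule mu_Union_le)
    also have "\<dots> = ennreal (mu A) + ennreal (mu B)"
      by (intro suminf_binaryset_eq) (simp add: empty)
    finally show ?thesis using mu_nonneg by (simp add: UN_binaryset_eq flip: ennreal_plus)
  qed
  have split: "mu (x \<inter> U) + mu (x - U) = mu x" if U: "open U" for U x
  proof (rule antisym)
    show "mu (x \<inter> U) + mu (x - U) \<le> mu x"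
    proof (rule mu_greatest)
      fix V assume V: "open V" "x \<subseteq> V"
      have "mu (x \<inter> U) \<le> rho (V \<inter> U)" using V U by (intro mu_lower) auto
      moreover have "mu (x - U) \<le> mu (V - U)" using V by (intro mu_mono) auto
      ultimately show "mu (x \<inter> U) + mu (x - U) \<le> rho V" using rho_split_open[OF U V(1)] by simp
    qed
    show "mu x \<le> mu (x \<inter> U) + mu (x - U)" using Un[of "x \<inter> U" "x - U"] by (simp add: Int_Diff_Un)
  qed
  let ?\<Lambda> = "lambda_system UNIV (Pow UNIV) ?f"
  have ms: "measure_space UNIV ?\<Lambda> ?f" using P.caratheodory_lemma[OF outer] .
  have open_in: "{S. open S} \<subseteq> ?\<Lambda>"
    using split mu_nonneg by (subst P.lambda_system_eq) (auto simp flip: ennreal_plus)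
  have sa: "sigma_algebra UNIV ?\<Lambda>" using ms by (simp add: measure_space_def)
  have "sets borel \<subseteq> ?\<Lambda>"
    using sigma_algebra.sigma_sets_subset[OF sa open_in] by (simp add: borel_def)
  then have "measure_space UNIV (sets (borel :: 'z measure)) ?f"
    using measure_down[OF ms] sets.sigma_algebra_axioms[of "borel :: 'z measure"] by simp
  then show ?thesis
    unfolding riesz_measure_def using assms
    by (intro emeasure_measure_of_sigma) (auto simp: measure_space_def)
qed

lemma measure_riesz_measure: "B \<in> sets borel \<Longrightarrow> measure riesz_measure B = mu B"
  by (simp add: measure_def emeasure_riesz_measure mu_nonneg)

lemma finite_measure_riesz: "finite_measure riesz_measure"
  by (intro finite_measureI) (simp add: emeasure_riesz_measure)

text \<open>An open \<open>U\<close> that nearly fits \<open>- B\<close> leaves the closed set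
  \<open>- U\<close> inside \<open>B\<close>, missing less than \<open>e / 2\<close>. Intersecting
  with the compact closed \<open>K\<close> of tightness loses at most another \<open>e / 2\<close>
  and gives compactness.\<close>

lemma riesz_measure_radon: "riesz_measure \<in> radon_measures"
proof -
  interpret finite_measure riesz_measure by (rule finite_measure_riesz)
  have "\<exists>K. compact K \<and> K \<in> sets borel \<and> K \<subseteq> B \<and> measure riesz_measure (B - K) < e"
    if B: "B \<in> sets borel" and e: "e > 0" for B e
  proof -
    obtain U where U: "open U" "- B \<subseteq> U" "rho U < mu (- B) + e / 2"
      using mu_outer[of "e / 2" "- B"] e by auto
    obtain K where K: "compact K" "closed K" and
      KL: "\<forall>f\<in>bcontfun. (\<forall>z. 0 \<le> f z \<and> f z \<le> 1) \<longrightarrow> (\<forall>z\<in>K. f z = 0) \<longrightarrow> L f \<le> e / 2"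
      using tight[of "e / 2"] e by auto
    have "rho (- K) \<le> e / 2"
    proof (rule rho_least)
      fix f assume f: "f \<in> subordinate (- K)"
      then have "\<forall>z\<in>K. f z = 0" using subordinate_outside by blast
      with f KL subordinate_le_1[OF f] show "L f \<le> e / 2" by (auto simp: subordinate_def)
    qed
    then have mK: "measure riesz_measure (- K) \<le> e / 2"
      using K by (simp add: measure_riesz_measure mu_open[OF open_Compl])
    have "measure riesz_measure U = measure riesz_measure (- B) + measure riesz_measure (B \<inter> U)"
      using U B by (subst finite_measure_Union[symmetric])
        (auto intro!: arg_cong[where f = "measure riesz_measure"])
    then have mU: "measure riesz_measure (B \<inter> U) < e / 2"
      using U borel_comp[OF B] by (simp add: measure_riesz_measure mu_open)
    have "measure riesz_measure (B - (K \<inter> - U)) \<le> measure riesz_measure ((B \<inter> U) \<union> - K)"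
      using B U K by (intro finite_measure_mono) auto
    also have "\<dots> \<le> measure riesz_measure (B \<inter> U) + measure riesz_measure (- K)"
      using B U K by (intro measure_Un_le) auto
    also have "\<dots> < e" using mU mK by simp
    finally show ?thesis
      using U K by (intro exI[of _ "K \<inter> - U"]) (auto intro: compact_Int_closed)
  qed
  then show ?thesis using finite_measure_riesz by (auto simp: radon_measures_def)
qed

text \<open>Cut \<open>real n * f\<close> into slices \<open>g k\<close>, each subordinate to the
  superlevel set \<open>U k\<close>, so that \<open>L (g k) \<le> rho (U k)\<close>. The indicators
  of the \<open>U k\<close> sum to at most \<open>real n * f + 1\<close>, and after division by
  \<open>n\<close> the surplus is the total mass over \<open>n\<close>, below \<open>e\<close> by
  the choice of \<open>n\<close>.\<close>

lemma L_le_integral_unit: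
  assumes f: "f \<in> bcontfun" "\<And>z. 0 \<le> f z" "\<And>z. f z \<le> 1"
  shows "L f \<le> (\<integral>z. f z \<partial>riesz_measure)"
proof (rule field_le_epsilon)
  fix e :: real assume e: "e > 0"
  interpret finite_measure riesz_measure by (rule finite_measure_riesz)
  let ?m = "measure riesz_measure UNIV"
  obtain n where n: "real n > ?m / e" using reals_Archimedean2 by blast
  have n0: "real n > 0" using n e by (meson divide_nonneg_pos le_less_trans measure_nonneg)
  define g where "g k z = max 0 (min 1 (real n * f z - real k))" for k z
  have gb: "g k \<in> bcontfun" for k unfolding g_def using f(1) by (intro bcontfun_intros)
  define U where "U k = {z. real n * f z > real k}" for k
  have U: "open (U k)" for k
    unfolding U_def using f(1) by (intro open_Collect_less continuous_intros) (auto simp: bcontfun_def)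
  have gU: "g k \<in> subordinate (U k)" for k
    using gb by (auto simp: subordinate_def g_def U_def indicator_def)
  have int: "integrable riesz_measure (indicator (U k) :: 'z \<Rightarrow> real)" for k
    using U by (auto intro!: integrable_real_indicator simp: emeasure_eq_measure)
  have fi: "integrable riesz_measure f"
    using f(1) finite_measure_axioms by (intro integrable_bcontfun) auto
  have "(\<lambda>z. real n * f z) = (\<lambda>z. \<Sum>k<n. g k z)"
    unfolding g_def using f by (subst sum_clamp) (auto simp: min_def mult_left_le)
  then have "real n * L f = (\<Sum>k<n. L (g k))"
    using scale[OF f(1), of "real n"] sum[of "{..<n}" g] gb by simp
  also have "\<dots> \<le> (\<Sum>k<n. measure riesz_measure (U k))"
    using rho_upper[OF gU] U by (intro sum_mono) (simp add: measure_riesz_measure mu_open)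
  also have "\<dots> = (\<integral>z. (\<Sum>k<n. indicator (U k) z) \<partial>riesz_measure)"
    using int U by (subst Bochner_Integration.integral_sum) auto
  also have "\<dots> \<le> (\<integral>z. real n * f z + 1 \<partial>riesz_measure)"
  proof (rule integral_mono)
    show "integrable riesz_measure (\<lambda>z. \<Sum>k<n. indicator (U k) z :: real)"
      using int by (intro Bochner_Integration.integrable_sum)
    show "(\<Sum>k<n. indicator (U k) z) \<le> real n * f z + 1" for z
      using layer_cake_upper[OF f(2), of n z] by (simp add: U_def indicator_def)
  qed (use fi in simp)
  also have "\<dots> = real n * (\<integral>z. f z \<partial>riesz_measure) + ?m"
    using fi by simp
  finally have "L f \<le> (\<integral>z. f z \<partial>riesz_measure) + ?m / real n"
    using n0 by (simp add: field_simps)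
  also have "?m / real n \<le> e" using n n0 e by (simp add: field_simps)
  finally show "L f \<le> (\<integral>z. f z \<partial>riesz_measure) + e" by simp
qed

lemma integral_riesz_measure:
  assumes f: "f \<in> bcontfun"
  shows "(\<integral>z. f z \<partial>riesz_measure) = L f"
proof -
  interpret finite_measure riesz_measure by (rule finite_measure_riesz)
  have total: "measure riesz_measure UNIV = L (\<lambda>_. 1)"
    by (simp add: measure_riesz_measure mu_open rho_UNIV)
  have unit: "(\<integral>z. g z \<partial>riesz_measure) = L g"
    if g: "g \<in> bcontfun" "\<And>z. 0 \<le> g z" "\<And>z. g z \<le> 1" for g
  proof (rule antisym)
    have gi: "integrable riesz_measure g"
      using g(1) finite_measure_axioms by (intro integrable_bcontfun) auto
    \<comment> \<open>The opposite inequality is the same estimate for \<open>1 - g\<close>, since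
      \<open>L\<close> and the integral agree on the constant 1.\<close>
    have "L (\<lambda>_. 1) - L g = L (\<lambda>z. 1 - g z)" using g(1) by (simp add: diff const_bcontfun)
    also have "\<dots> \<le> (\<integral>z. 1 - g z \<partial>riesz_measure)"
      using g by (intro L_le_integral_unit bcontfun_intros) auto
    also have "\<dots> = L (\<lambda>_. 1) - (\<integral>z. g z \<partial>riesz_measure)" using gi total by simp
    finally show "(\<integral>z. g z \<partial>riesz_measure) \<le> L g" by simp
  qed (rule L_le_integral_unit[OF g])
  obtain b where b: "b > 0" "\<And>z. \<bar>f z\<bar> \<le> b"
    using f by (auto simp: bcontfun_def bounded_pos)
  define g where "g z = (1 / (2 * b)) * (f z + b)" for z
  have gb: "g \<in> bcontfun" unfolding g_def using f by (intro bcontfun_intros)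
  have "0 \<le> g z" "g z \<le> 1" for z
    using b(1) b(2)[of z] by (auto simp: g_def field_simps abs_le_iff)
  then have "(\<integral>z. g z \<partial>riesz_measure) = L g" using gb by (intro unit)
  moreover have "integrable riesz_measure f"
    using f finite_measure_axioms by (intro integrable_bcontfun) auto
  then have "(\<integral>z. g z \<partial>riesz_measure) = (1 / (2 * b)) * ((\<integral>z. f z \<partial>riesz_measure) + b * L (\<lambda>_. 1))"
    unfolding g_def using total by simp
  moreover have "L g = (1 / (2 * b)) * (L f + b * L (\<lambda>_. 1))"
    unfolding g_def using f by (subst scale) (auto simp: add const_bcontfun const[of b] intro!: bcontfun_intros)
  ultimately show ?thesis using b(1) by simp
qed

end

section \<open>Approximation of lower semicontinuous functions\<close>

text \<open>The maximum of the approximants for \<open>M\<close> and \<open>N\<close> is at least as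
  good as each and still lies below the indicator. A common \<open>w\<close> is needed because the
  same \<open>v\<close> enters both integrals of the dual cost.\<close>

lemma radon_open_approximation2:
  fixes p :: "'z::topological_space \<Rightarrow> 'a::topological_space"
  assumes cr: "completely_regular_space (euclidean :: 'a topology)"
    and M: "M \<in> radon_measures" and N: "N \<in> radon_measures"
    and p: "continuous_on UNIV p" and U: "open U" and e: "e > 0"
  shows "\<exists>w :: 'a \<Rightarrow> real. w \<in> bcontfun \<and> (\<forall>x. 0 \<le> w x \<and> w x \<le> indicator U x) \<and>
    (\<integral>z. indicator U (p z) - w (p z) \<partial>M) < e \<and> (\<integral>z. indicator U (p z) - w (p z) \<partial>N) < e"
proof -
  obtain w1 :: "'a \<Rightarrow> real" where w1: "w1 \<in> bcontfun" "\<And>x. 0 \<le> w1 x" "\<And>x. w1 x \<le> indicator U x"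
    "(\<integral>z. indicator U (p z) - w1 (p z) \<partial>M) < e"
    using radon_open_approximation[OF cr M p U e] by metis
  obtain w2 :: "'a \<Rightarrow> real" where w2: "w2 \<in> bcontfun" "\<And>x. 0 \<le> w2 x" "\<And>x. w2 x \<le> indicator U x"
    "(\<integral>z. indicator U (p z) - w2 (p z) \<partial>N) < e"
    using radon_open_approximation[OF cr N p U e] by metis
  define w where "w x = max (w1 x) (w2 x)" for x
  have wb: "w \<in> bcontfun" unfolding w_def by (intro max_bcontfun w1 w2)
  have int: "integrable R (\<lambda>z. indicator U (p z) - g (p z))"
    if R: "R \<in> radon_measures" and g: "g \<in> bcontfun" for R and g :: "'a \<Rightarrow> real"
  proof -
    have [simp]: "sets R = sets borel" using radon_measuresD[OF R] by simp
    interpret finite_measure R using radon_measuresD[OF R] by blast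
    have "p -` U \<in> sets borel" using p U by (simp add: open_vimage)
    then have "integrable R (indicator (p -` U) :: 'z \<Rightarrow> real)"
      by (auto intro!: integrable_real_indicator simp: emeasure_eq_measure)
    from Bochner_Integration.integrable_diff[OF this
        integrable_bcontfun_compose[OF finite_measure_axioms _ g p]]
    show ?thesis by (simp add: indicator_vimage)
  qed
  have "(\<integral>z. indicator U (p z) - w (p z) \<partial>M) \<le> (\<integral>z. indicator U (p z) - w1 (p z) \<partial>M)"
    by (intro integral_mono int M wb w1) (simp add: w_def)
  moreover have "(\<integral>z. indicator U (p z) - w (p z) \<partial>N) \<le> (\<integral>z. indicator U (p z) - w2 (p z) \<partial>N)"
    by (intro integral_mono int N wb w2) (simp add: w_def)
  ultimately show ?thesis
    using wb w1 w2 by (intro exI[of _ w]) (auto simp: w_def le_max_iff_disj)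
qed

lemma lower_semicontinuous_borel:
  fixes v :: "'a::topological_space \<Rightarrow> real"
  assumes "\<And>c. open {x. c < v x}"
  shows "v \<in> borel_measurable borel"
  using assms by (simp add: borel_measurable_iff_greater borel_open)

text \<open>Up to \<open>1 / n\<close>, \<open>v\<close> is the average of the indicators of its
  superlevel sets at the levels \<open>k / n\<close>. These sets are open, so each indicator has a
  continuous approximant from below.\<close>

lemma lower_semicontinuous_approximation_unit:
  fixes p :: "'z::topological_space \<Rightarrow> 'a::topological_space" and v :: "'a \<Rightarrow> real"
  assumes cr: "completely_regular_space (euclidean :: 'a topology)"
    and M: "M \<in> radon_measures" and N: "N \<in> radon_measures" and p: "continuous_on UNIV p"
    and lsc: "\<And>c. open {x. c < v x}" and v01: "\<And>x. 0 \<le> v x" "\<And>x. v x \<le> 1" and e: "e > 0"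
  obtains w :: "'a \<Rightarrow> real" where "w \<in> bcontfun"
    "(\<integral>z. \<bar>v (p z) - w (p z)\<bar> \<partial>M) \<le> e" "(\<integral>z. \<bar>v (p z) - w (p z)\<bar> \<partial>N) \<le> e"
proof -
  \<comment> \<open>This makes the discretization error, total mass over \<open>n\<close>, at most
    \<open>e / 2\<close> for each measure; averaging the indicator errors uses the other
    \<open>e / 2\<close>.\<close>
  obtain n where n: "real n > 2 * (measure M UNIV + measure N UNIV) / e"
    using reals_Archimedean2 by blast
  have n0: "real n > 0"
    using n e by (meson divide_nonneg_pos le_less_trans measure_nonneg add_nonneg_nonneg
        mult_nonneg_nonneg zero_le_numeral)
  define U where "U k = {x. real k < real n * v x}" for k
  have "U k = {x. real k / real n < v x}" for k using n0 by (auto simp: U_def field_simps)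
  then have U: "open (U k)" for k using lsc by simp
  have "\<forall>k. \<exists>w :: 'a \<Rightarrow> real. w \<in> bcontfun \<and> (\<forall>x. 0 \<le> w x \<and> w x \<le> indicator (U k) x) \<and>
      (\<integral>z. indicator (U k) (p z) - w (p z) \<partial>M) < e / 2 \<and>
      (\<integral>z. indicator (U k) (p z) - w (p z) \<partial>N) < e / 2"
    using e by (intro allI radon_open_approximation2[OF cr M N p U]) simp
  from choice[OF this] obtain w :: "nat \<Rightarrow> 'a \<Rightarrow> real" where
    "\<forall>k. w k \<in> bcontfun \<and> (\<forall>x. 0 \<le> w k x \<and> w k x \<le> indicator (U k) x) \<and>
      (\<integral>z. indicator (U k) (p z) - w k (p z) \<partial>M) < e / 2 \<and>
      (\<integral>z. indicator (U k) (p z) - w k (p z) \<partial>N) < e / 2" ..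
  then have w: "\<And>k. w k \<in> bcontfun" "\<And>k x. w k x \<le> indicator (U k) x"
    "\<And>k. (\<integral>z. indicator (U k) (p z) - w k (p z) \<partial>M) < e / 2"
    "\<And>k. (\<integral>z. indicator (U k) (p z) - w k (p z) \<partial>N) < e / 2"
    by blast+
  define W where "W x = (1 / real n) * (\<Sum>k<n. w k x)" for x
  have Wb: "W \<in> bcontfun" unfolding W_def using w(1) by (intro bcontfun_intros)
  have close: "\<bar>v x - W x\<bar> \<le> (1 / real n) * (1 + (\<Sum>k<n. indicator (U k) x - w k x))" for x
  proof -
    define I where "I = (\<Sum>k<n. indicator (U k) x :: real)"
    have "real n * v x \<le> I" "I \<le> real n * v x + 1"
      using layer_cake_lower[OF v01[of x], of n] layer_cake_upper[OF v01(1)[of x], of n]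
      by (auto simp: I_def U_def indicator_def)
    moreover have "(\<Sum>k<n. w k x) \<le> I" unfolding I_def using w(2) by (intro sum_mono)
    ultimately have "\<bar>real n * v x - (\<Sum>k<n. w k x)\<bar> \<le> 1 + (I - (\<Sum>k<n. w k x))" by linarith
    moreover have "real n * v x - (\<Sum>k<n. w k x) = real n * (v x - W x)"
      using n0 by (simp add: W_def right_diff_distrib)
    then have "\<bar>real n * v x - (\<Sum>k<n. w k x)\<bar> = real n * \<bar>v x - W x\<bar>" by (simp add: abs_mult)
    ultimately show ?thesis using n0 by (simp add: I_def sum_subtractf field_simps)
  qed
  have est: "(\<integral>z. \<bar>v (p z) - W (p z)\<bar> \<partial>R) \<le> e"
    if R: "R \<in> radon_measures" and Re: "measure R UNIV / real n \<le> e / 2"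
      and wR: "\<And>k. (\<integral>z. indicator (U k) (p z) - w k (p z) \<partial>R) < e / 2" for R
  proof -
    interpret finite_measure R using radon_measuresD[OF R] by blast
    have [simp]: "sets R = sets borel" "space R = UNIV" using radon_measuresD[OF R] by auto
    have int: "integrable R (\<lambda>z. indicator (U k) (p z) - w k (p z))" for k
    proof -
      have "p -` U k \<in> sets borel" using p U by (simp add: open_vimage)
      then have "integrable R (indicator (p -` U k) :: 'z \<Rightarrow> real)"
        by (auto intro!: integrable_real_indicator simp: emeasure_eq_measure)
      from Bochner_Integration.integrable_diff[OF this
          integrable_bcontfun_compose[OF finite_measure_axioms _ w(1) p]]
      show ?thesis by (simp add: indicator_vimage)
    qed
    have "(\<integral>z. \<bar>v (p z) - W (p z)\<bar> \<partial>R)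
        \<le> (\<integral>z. (1 / real n) * (1 + (\<Sum>k<n. indicator (U k) (p z) - w k (p z))) \<partial>R)"
    proof (rule integral_mono')
      show "integrable R (\<lambda>z. (1 / real n) * (1 + (\<Sum>k<n. indicator (U k) (p z) - w k (p z))))"
        using int by (intro integrable_mult_right Bochner_Integration.integrable_add
            Bochner_Integration.integrable_sum) auto
    qed (rule close order_trans[OF abs_ge_zero close])+
    also have "\<dots> = (1 / real n) * (measure R UNIV
        + (\<Sum>k<n. (\<integral>z. indicator (U k) (p z) - w k (p z) \<partial>R)))"
      using int by (simp add: Bochner_Integration.integral_sum Bochner_Integration.integrable_sum)
    also have "\<dots> \<le> (1 / real n) * (measure R UNIV + (\<Sum>k<n. e / 2))"
      using n0 wR by (intro mult_left_mono add_left_mono sum_mono) (auto simp: less_imp_le)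
    also have "\<dots> = measure R UNIV / real n + e / 2" using n0 by (simp add: field_simps)
    finally show ?thesis using Re by linarith
  qed
  have "2 * measure M UNIV + 2 * measure N UNIV \<le> e * real n"
    using n e n0 by (simp add: field_simps)
  then have "2 * measure M UNIV \<le> e * real n" "2 * measure N UNIV \<le> e * real n"
    using measure_nonneg[of M UNIV] measure_nonneg[of N UNIV] by linarith+
  then have "measure M UNIV / real n \<le> e / 2" "measure N UNIV / real n \<le> e / 2"
    using n0 by (simp_all add: field_simps)
  then show thesis using Wb est[OF M _ w(3)] est[OF N _ w(4)] by (intro that[of W])
qed

lemma lower_semicontinuous_approximation:
  fixes p :: "'z::topological_space \<Rightarrow> 'a::topological_space" and v :: "'a \<Rightarrow> real"
  assumes cr: "completely_regular_space (euclidean :: 'a topology)"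
    and M: "M \<in> radon_measures" and N: "N \<in> radon_measures" and p: "continuous_on UNIV p"
    and lsc: "\<And>c. open {x. c < v x}" and b: "\<And>x. \<bar>v x\<bar> \<le> b" and e: "e > 0"
  obtains w :: "'a \<Rightarrow> real" where "w \<in> bcontfun"
    "(\<integral>z. \<bar>v (p z) - w (p z)\<bar> \<partial>M) \<le> e" "(\<integral>z. \<bar>v (p z) - w (p z)\<bar> \<partial>N) \<le> e"
proof -
  \<comment> \<open>The added 1 keeps the divisor \<open>2 * B\<close> positive also when
    \<open>b = 0\<close>.\<close>
  define B where "B = \<bar>b\<bar> + 1"
  have B: "B > 0" "\<bar>v x\<bar> \<le> B" for x using b[of x] by (auto simp: B_def)
  define v' where "v' x = (v x + B) / (2 * B)" for x
  have "{x. c < v' x} = {x. 2 * B * c - B < v x}" for c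
    using B(1) by (auto simp: v'_def field_simps)
  then have lsc': "open {x. c < v' x}" for c using lsc by simp
  have v'01: "0 \<le> v' x" "v' x \<le> 1" for x
    using B(1) B(2)[of x] by (auto simp: v'_def field_simps abs_le_iff)
  have "e / (2 * B) > 0" using e B(1) by simp
  then obtain w' :: "'a \<Rightarrow> real" where w': "w' \<in> bcontfun"
    "(\<integral>z. \<bar>v' (p z) - w' (p z)\<bar> \<partial>M) \<le> e / (2 * B)" "(\<integral>z. \<bar>v' (p z) - w' (p z)\<bar> \<partial>N) \<le> e / (2 * B)"
    by (rule lower_semicontinuous_approximation_unit[OF cr M N p lsc' v'01])
  define w where "w x = 2 * B * w' x - B" for x
  have wb: "w \<in> bcontfun" unfolding w_def using w'(1) by (intro bcontfun_intros)
  have "\<bar>v x - w x\<bar> = 2 * B * \<bar>v' x - w' x\<bar>" for x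
  proof -
    have "v x - w x = 2 * B * (v' x - w' x)" using B(1) by (simp add: v'_def w_def field_simps)
    then show ?thesis using B(1) by (simp add: abs_mult)
  qed
  then show thesis using w' B(1) by (intro that[OF wb]) (simp_all add: field_simps)
qed

lemma integral_mono_dominated_measure:
  fixes f :: "'a::topological_space \<Rightarrow> real"
  assumes M: "finite_measure M" "sets M = sets borel" and N: "finite_measure N" "sets N = sets borel"
    and le: "\<And>B. B \<in> sets borel \<Longrightarrow> emeasure M B \<le> emeasure N B"
    and f: "f \<in> bcontfun" "\<And>x. 0 \<le> f x"
  shows "(\<integral>x. f x \<partial>M) \<le> (\<integral>x. f x \<partial>N)"
proof -
  have "M \<le> N" using M N le by (subst le_measure) auto
  then have "(\<integral>\<^sup>+x. ennreal (f x) \<partial>M) \<le> (\<integral>\<^sup>+x. ennreal (f x) \<partial>N)"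
    using M N by (intro nn_integral_mono_measure) auto
  then show ?thesis
    using f integrable_bcontfun[OF M f(1)] integrable_bcontfun[OF N f(1)]
    by (simp add: nn_integral_eq_integral integral_nonneg_AE)
qed

lemma distr_projections:
  "distr \<gamma> borel (\<lambda>(x, y, s). (x, s)) = distr \<gamma> borel (\<lambda>z. (fst z, snd (snd z)))"
  "distr \<gamma> borel (\<lambda>(x, y, s). (y, s)) = distr \<gamma> borel snd"
  "distr \<gamma> borel (\<lambda>(x, y, s). x) = distr \<gamma> borel fst"
  "distr \<gamma> borel (\<lambda>(x, y, s). y) = distr \<gamma> borel (\<lambda>z. fst (snd z))"
  by (simp_all add: case_prod_unfold)

lemma compact_box_neighbourhood:
  fixes A :: "'a::topological_space set" and B :: "'b::topological_space set"
  assumes "compact A" "compact B" "open W" "A \<times> B \<subseteq> W"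
  obtains U V where "open U" "open V" "A \<subseteq> U" "B \<subseteq> V" "U \<times> V \<subseteq> W"
  using Wallace_theorem_prod_topology[of euclidean A euclidean B W] assms by auto

section \<open>The exchange problem\<close>

locale exchange_problem =
  fixes \<pi>p \<pi>m :: "('x::topological_space \<times> 's::topological_space) measure"
  assumes crX: "completely_regular_space (euclidean :: 'x topology)"
    and crS: "completely_regular_space (euclidean :: 's topology)"
    and rp: "\<pi>p \<in> radon_measures" and rm: "\<pi>m \<in> radon_measures"
begin

lemma crXS: "completely_regular_space (euclidean :: ('x \<times> 's) topology)"
  using completely_regular_space_prod_topology[of "euclidean :: 'x topology" "euclidean :: 's topology"]
    crX crS by simp

lemma crXXS: "completely_regular_space (euclidean :: ('x \<times> 'x \<times> 's) topology)"
  using completely_regular_space_prod_topology[of "euclidean :: 'x topology"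
      "euclidean :: ('x \<times> 's) topology"] crX crXS by simp

sublocale p: finite_measure \<pi>p using radon_measuresD[OF rp] by blast
sublocale m: finite_measure \<pi>m using radon_measuresD[OF rm] by blast

lemma sets_pi [simp]: "sets \<pi>p = sets borel" "sets \<pi>m = sets borel"
  and space_pi [simp]: "space \<pi>p = UNIV" "space \<pi>m = UNIV"
  using radon_measuresD[OF rp] radon_measuresD[OF rm] by auto

lemma integrable_pi: "f \<in> bcontfun \<Longrightarrow> integrable \<pi>p (f :: _ \<Rightarrow> real)"
  "f \<in> bcontfun \<Longrightarrow> integrable \<pi>m (f :: _ \<Rightarrow> real)"
  using integrable_bcontfun p.finite_measure_axioms m.finite_measure_axioms sets_pi by blast+

section \<open>The gauge of a test function and a linear functional below it\<close>

definition cost :: "('x \<times> 's \<Rightarrow> real) \<Rightarrow> ('x \<times> 's \<Rightarrow> real) \<Rightarrow> real" where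
  "cost a b = (\<integral>z. max (a z) 0 \<partial>\<pi>p) + (\<integral>z. max (b z) 0 \<partial>\<pi>m)"

text \<open>Each entry is a multiplier for one constraint on plans. \<open>a\<close> and
  \<open>b\<close> belong to the two dominated marginals, hence only their positive parts are
  charged by \<open>cost\<close>. \<open>u\<close> belongs to the equality of the \<open>X\<close>
  and \<open>Y\<close> marginals; it is free of charge and may be replaced by its negative in
  testing.\<close>

definition majorants ::
  "('x \<times> 'x \<times> 's \<Rightarrow> real) \<Rightarrow> (('x \<times> 's \<Rightarrow> real) \<times> ('x \<times> 's \<Rightarrow> real) \<times> ('x \<Rightarrow> real)) set" where
  "majorants h = {(a, b, u). a \<in> bcontfun \<and> b \<in> bcontfun \<and> u \<in> bcontfun \<and>
     (\<forall>x y s. h (x, y, s) \<le> a (x, s) + b (y, s) + u x - u y)}"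

definition gauge :: "('x \<times> 'x \<times> 's \<Rightarrow> real) \<Rightarrow> real" where
  "gauge h = (INF (a, b, u)\<in>majorants h. cost a b)"

lemma cost_nonneg: "0 \<le> cost a b"
  unfolding cost_def by (intro add_nonneg_nonneg integral_nonneg) auto

lemma majorants_nonempty:
  assumes "h \<in> bcontfun"
  shows "majorants h \<noteq> {}"
proof -
  obtain c where "\<And>z. \<bar>h z\<bar> \<le> c" using assms by (auto simp: bcontfun_def bounded_iff)
  then have "h z \<le> c" for z by (auto simp: abs_le_iff)
  then have "((\<lambda>_. c), (\<lambda>_. 0), (\<lambda>_. 0)) \<in> majorants h"
    by (simp add: majorants_def const_bcontfun)
  then show ?thesis by blast
qed

lemma gauge_lower: "(a, b, u) \<in> majorants h \<Longrightarrow> gauge h \<le> cost a b"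
  unfolding gauge_def using cost_nonneg
  by (intro cINF_lower2[where x = "(a, b, u)"] bdd_belowI2[of _ 0]) auto

lemma gauge_greatest:
  assumes "h \<in> bcontfun" "\<And>a b u. (a, b, u) \<in> majorants h \<Longrightarrow> c \<le> cost a b"
  shows "c \<le> gauge h"
  unfolding gauge_def using assms majorants_nonempty by (intro cINF_greatest) auto

lemma cost_add:
  assumes "a \<in> bcontfun" "b \<in> bcontfun" "a' \<in> bcontfun" "b' \<in> bcontfun"
  shows "cost (\<lambda>z. a z + a' z) (\<lambda>z. b z + b' z) \<le> cost a b + cost a' b'"
proof -
  have "(\<integral>z. max (a z + a' z) 0 \<partial>\<pi>p) \<le> (\<integral>z. max (a z) 0 + max (a' z) 0 \<partial>\<pi>p)"
    by (rule integral_mono) (use assms in \<open>auto intro!: integrable_pi bcontfun_intros\<close>)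
  also have "\<dots> = (\<integral>z. max (a z) 0 \<partial>\<pi>p) + (\<integral>z. max (a' z) 0 \<partial>\<pi>p)"
    using assms by (intro Bochner_Integration.integral_add integrable_pi bcontfun_intros)
  finally have 1: "(\<integral>z. max (a z + a' z) 0 \<partial>\<pi>p) \<le> (\<integral>z. max (a z) 0 \<partial>\<pi>p) + (\<integral>z. max (a' z) 0 \<partial>\<pi>p)" .
  have "(\<integral>z. max (b z + b' z) 0 \<partial>\<pi>m) \<le> (\<integral>z. max (b z) 0 + max (b' z) 0 \<partial>\<pi>m)"
    by (rule integral_mono) (use assms in \<open>auto intro!: integrable_pi bcontfun_intros\<close>)
  also have "\<dots> = (\<integral>z. max (b z) 0 \<partial>\<pi>m) + (\<integral>z. max (b' z) 0 \<partial>\<pi>m)"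
    using assms by (intro Bochner_Integration.integral_add integrable_pi bcontfun_intros)
  finally show ?thesis using 1 by (simp add: cost_def)
qed

lemma cost_scale:
  assumes "c > 0"
  shows "cost (\<lambda>z. c * a z) (\<lambda>z. c * b z) = c * cost a b"
proof -
  have "max (c * t) 0 = c * max t 0" for t
    using assms by (simp add: max_mult_distrib_left)
  then show ?thesis by (simp add: cost_def distrib_left)
qed

lemma gauge_add:
  assumes "g \<in> bcontfun" "h \<in> bcontfun"
  shows "gauge (\<lambda>z. g z + h z) \<le> gauge g + gauge h"
proof -
  have *: "gauge (\<lambda>z. g z + h z) \<le> cost a b + cost a' b'"
    if ab: "(a, b, u) \<in> majorants g" and ab': "(a', b', u') \<in> majorants h" for a b u a' b' u'
  proof -
    have "g (x, y, s) + h (x, y, s) \<le>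
        (a (x, s) + a' (x, s)) + (b (y, s) + b' (y, s)) + (u x + u' x) - (u y + u' y)" for x y s
    proof -
      have "g (x, y, s) \<le> a (x, s) + b (y, s) + u x - u y" using ab by (simp add: majorants_def)
      moreover have "h (x, y, s) \<le> a' (x, s) + b' (y, s) + u' x - u' y"
        using ab' by (simp add: majorants_def)
      ultimately show ?thesis by linarith
    qed
    then have "((\<lambda>z. a z + a' z), (\<lambda>z. b z + b' z), (\<lambda>x. u x + u' x)) \<in> majorants (\<lambda>z. g z + h z)"
      using ab ab' by (simp add: majorants_def plus_cont)
    from gauge_lower[OF this] cost_add[of a b a' b'] ab ab' show ?thesis
      by (simp add: majorants_def)
  qed
  have "gauge (\<lambda>z. g z + h z) - cost a b \<le> gauge h" if "(a, b, u) \<in> majorants g" for a b u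
    using *[OF that] by (intro gauge_greatest assms) (simp add: algebra_simps)
  then have "gauge (\<lambda>z. g z + h z) - gauge h \<le> gauge g"
    by (intro gauge_greatest assms) (simp add: algebra_simps)
  then show ?thesis by simp
qed

lemma gauge_scale:
  assumes "h \<in> bcontfun" "c > 0"
  shows "gauge (\<lambda>z. c * h z) \<le> c * gauge h"
proof -
  have "gauge (\<lambda>z. c * h z) / c \<le> gauge h"
  proof (rule gauge_greatest[OF assms(1)])
    fix a b u assume ab: "(a, b, u) \<in> majorants h"
    have "c * h (x, y, s) \<le> c * a (x, s) + c * b (y, s) + c * u x - c * u y" for x y s
    proof -
      have "h (x, y, s) \<le> a (x, s) + b (y, s) + u x - u y" using ab by (simp add: majorants_def)
      then have "c * h (x, y, s) \<le> c * (a (x, s) + b (y, s) + u x - u y)"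
        using assms(2) by (intro mult_left_mono) auto
      then show ?thesis by (simp add: algebra_simps)
    qed
    then have "((\<lambda>z. c * a z), (\<lambda>z. c * b z), (\<lambda>x. c * u x)) \<in> majorants (\<lambda>z. c * h z)"
      using ab by (simp add: majorants_def scaled_bcontfun)
    from gauge_lower[OF this] show "gauge (\<lambda>z. c * h z) / c \<le> cost a b"
      using assms(2) by (simp add: cost_scale field_simps)
  qed
  then show ?thesis using assms(2) by (simp add: field_simps)
qed

text \<open>Hahn-Banach is stated for a vector space type, so it is applied on the type of bounded
  continuous functions, and \<open>Bcontfun\<close> transports the result back to plain functions in
  \<open>bcontfun\<close>.\<close>

lemma gauge_functional:
  obtains L where "\<And>f g. f \<in> bcontfun \<Longrightarrow> g \<in> bcontfun \<Longrightarrow> L (\<lambda>z. f z + g z) = L f + L g"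
    and "\<And>f c. f \<in> bcontfun \<Longrightarrow> L (\<lambda>z. c * f z) = c * L f"
    and "\<And>f. f \<in> bcontfun \<Longrightarrow> L f \<le> gauge f"
    and "L (\<lambda>_. 1 :: real) = gauge (\<lambda>_. 1)"
proof -
  have "sublinear (\<lambda>h. gauge (apply_bcontfun h))"
    by (rule sublinearI) (simp_all add: gauge_add gauge_scale apply_bcontfun)
  then obtain L' :: "(('x \<times> 'x \<times> 's) \<Rightarrow>\<^sub>C real) \<Rightarrow> real" where L': "linear L'"
    "\<And>h. L' h \<le> gauge (apply_bcontfun h)"
    "L' (const_bcontfun 1) = gauge (apply_bcontfun (const_bcontfun 1))"
    using Hahn_Banach_sublinear[of _ "const_bcontfun 1"] by metis
  show thesis
  proof (rule that[of "\<lambda>f. L' (Bcontfun f)"])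
    fix f g :: "'x \<times> 'x \<times> 's \<Rightarrow> real" and c :: real
    assume f: "f \<in> bcontfun"
    have "Bcontfun (\<lambda>z. c * f z) = c *\<^sub>R Bcontfun f"
      using f by (intro bcontfun_eqI) (simp add: Bcontfun_inverse scaled_bcontfun)
    then show "L' (Bcontfun (\<lambda>z. c * f z)) = c * L' (Bcontfun f)"
      using linear_scale[OF L'(1)] by simp
    show "L' (Bcontfun f) \<le> gauge f" using L'(2)[of "Bcontfun f"] f by (simp add: Bcontfun_inverse)
    assume g: "g \<in> bcontfun"
    have "Bcontfun (\<lambda>z. f z + g z) = Bcontfun f + Bcontfun g"
      using f g by (intro bcontfun_eqI) (simp add: Bcontfun_inverse plus_cont)
    then show "L' (Bcontfun (\<lambda>z. f z + g z)) = L' (Bcontfun f) + L' (Bcontfun g)"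
      using linear_add[OF L'(1)] by simp
  next
    have "Bcontfun (\<lambda>_. 1) = (const_bcontfun 1 :: ('x \<times> 'x \<times> 's) \<Rightarrow>\<^sub>C real)"
      by (intro bcontfun_eqI) (simp add: Bcontfun_inverse const_bcontfun)
    then show "L' (Bcontfun (\<lambda>_. 1)) = gauge (\<lambda>_. 1)" using L'(3) by simp
  qed
qed

text \<open>If \<open>f\<close> vanishes on \<open>A \<times> B \<times> C\<close>, it stays below
  \<open>\<delta>\<close> on an open box around it. A point outside the box leaves it in one
  coordinate: leaving in \<open>x\<close> or \<open>s\<close> is charged to \<open>a\<close>,
  leaving in \<open>y\<close> to \<open>b\<close>, and the resulting cost is small because
  \<open>\<pi>p\<close> and \<open>\<pi>m\<close> are concentrated on \<open>K1\<close> and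
  \<open>K2\<close>.\<close>

lemma gauge_tight:
  assumes e: "e > 0"
  shows "\<exists>K. compact K \<and> closed K \<and>
    (\<forall>f\<in>bcontfun. (\<forall>z. 0 \<le> f z \<and> f z \<le> 1) \<longrightarrow> (\<forall>z\<in>K. f z = 0) \<longrightarrow> gauge f \<le> e)"
proof -
  define m where "m = measure \<pi>p UNIV"
  have m: "m \<ge> 0" by (simp add: m_def)
  \<comment> \<open>The cost consists of \<open>\<delta> * m\<close> from the constant in
    \<open>a\<close>, at most \<open>2 * \<delta>\<close> from its two escape terms off
    \<open>K1\<close>, and at most \<open>\<delta>\<close> from \<open>b\<close> off
    \<open>K2\<close>.\<close>
  define \<delta> where "\<delta> = e / (m + 3)"
  have \<delta>: "\<delta> > 0" using e m by (simp add: \<delta>_def)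
  have "\<delta> * (m + 3) = e" using m by (simp add: \<delta>_def)
  then have \<delta>e: "\<delta> * measure \<pi>p UNIV + 3 * \<delta> = e" by (simp add: algebra_simps m_def)
  obtain K1 where K1: "compact K1" "K1 \<in> sets borel" "measure \<pi>p (UNIV - K1) < \<delta>"
    using radon_measuresD(4)[OF rp, of UNIV \<delta>] \<delta> by auto
  obtain K2 where K2: "compact K2" "K2 \<in> sets borel" "measure \<pi>m (UNIV - K2) < \<delta>"
    using radon_measuresD(4)[OF rm, of UNIV \<delta>] \<delta> by auto
  define A where "A = closure (fst ` K1)"
  define B where "B = closure (fst ` K2)"
  define C where "C = closure (snd ` K1)"
  note reg = completely_regular_imp_regular_space
  have A: "compact A" and B: "compact B" and C: "compact C"
    unfolding A_def B_def C_def using K1 K2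
    by (auto intro!: regular_compact_closure reg crX crS compact_continuous_image continuous_intros)
  have gauge_le: "gauge f \<le> e"
    if f: "f \<in> bcontfun" "\<And>z. f z \<le> 1" "\<And>z. z \<in> A \<times> B \<times> C \<Longrightarrow> f z = 0" for f
  proof -
    define W where "W = {z. f z < \<delta>}"
    have W: "open W"
      unfolding W_def using f(1) by (intro open_Collect_less) (auto simp: bcontfun_def)
    have "A \<times> B \<times> C \<subseteq> W" using f(3) \<delta> by (auto simp: W_def)
    with A B C W obtain U1 V where U1: "open U1" "A \<subseteq> U1" and V: "open V" "B \<times> C \<subseteq> V" "U1 \<times> V \<subseteq> W"
      using compact_box_neighbourhood[of A "B \<times> C" W] by (metis compact_Times)
    from B C V obtain U2 U3 where U2: "open U2" "B \<subseteq> U2" and U3: "open U3" "C \<subseteq> U3" and "U2 \<times> U3 \<subseteq> V"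
      using compact_box_neighbourhood[of B C V] by metis
    with V have box: "U1 \<times> U2 \<times> U3 \<subseteq> W" by auto
    obtain wA :: "'x \<Rightarrow> real" where wA: "wA \<in> bcontfun" "\<And>x. 0 \<le> wA x" "\<And>x. wA x \<le> 1"
      "\<And>x. x \<in> A \<Longrightarrow> wA x = 1" "\<And>x. x \<notin> U1 \<Longrightarrow> wA x = 0"
      using bcontfun_separate[OF crX A U1] by metis
    obtain wB :: "'x \<Rightarrow> real" where wB: "wB \<in> bcontfun" "\<And>x. 0 \<le> wB x" "\<And>x. wB x \<le> 1"
      "\<And>x. x \<in> B \<Longrightarrow> wB x = 1" "\<And>x. x \<notin> U2 \<Longrightarrow> wB x = 0"
      using bcontfun_separate[OF crX B U2] by metis
    obtain wC :: "'s \<Rightarrow> real" where wC: "wC \<in> bcontfun" "\<And>x. 0 \<le> wC x" "\<And>x. wC x \<le> 1"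
      "\<And>x. x \<in> C \<Longrightarrow> wC x = 1" "\<And>x. x \<notin> U3 \<Longrightarrow> wC x = 0"
      using bcontfun_separate[OF crS C U3] by metis
    define a where "a z = \<delta> + (1 - wA (fst z)) + (1 - wC (snd z))" for z :: "'x \<times> 's"
    define b where "b z = 1 - wB (fst z)" for z :: "'x \<times> 's"
    have ab: "a \<in> bcontfun" "b \<in> bcontfun"
      unfolding a_def b_def using wA(1) wB(1) wC(1)
      by (auto intro!: bcontfun_intros compose_bcontfun[where g = fst] compose_bcontfun[where g = snd]
          continuous_intros)
    have a0: "0 \<le> a z" and b0: "0 \<le> b z" for z
      using wA(3)[of "fst z"] wB(3)[of "fst z"] wC(3)[of "snd z"] \<delta> by (auto simp: a_def b_def)
    have "f (x, y, s) \<le> a (x, s) + b (y, s)" for x y s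
    proof (cases "(x, y, s) \<in> U1 \<times> U2 \<times> U3")
      case True
      then have "f (x, y, s) < \<delta>" using box by (auto simp: W_def)
      then show ?thesis using wA(3)[of x] wB(3)[of y] wC(3)[of s] by (simp add: a_def b_def)
    next
      case False
      then have "wA x = 0 \<or> wB y = 0 \<or> wC s = 0" using wA(5) wB(5) wC(5) by auto
      then show ?thesis
        using f(2)[of "(x, y, s)"] wA(3)[of x] wB(3)[of y] wC(3)[of s] \<delta> by (auto simp: a_def b_def)
    qed
    then have "(a, b, \<lambda>_. 0) \<in> majorants f" using ab by (simp add: majorants_def const_bcontfun)
    then have "gauge f \<le> cost a b" by (rule gauge_lower)
    also have "\<dots> = (\<integral>z. a z \<partial>\<pi>p) + (\<integral>z. b z \<partial>\<pi>m)" using a0 b0 by (simp add: cost_def)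
    also have "(\<integral>z. a z \<partial>\<pi>p) \<le> (\<integral>z. \<delta> + 2 * indicator (UNIV - K1) z \<partial>\<pi>p)"
    proof (rule integral_mono)
      show "integrable \<pi>p a" using ab by (intro integrable_pi)
      show "integrable \<pi>p (\<lambda>z. \<delta> + 2 * indicator (UNIV - K1) z)"
        using K1 by (auto intro!: integrable_real_indicator simp: p.emeasure_eq_measure)
      fix z
      have "fst z \<in> A" "snd z \<in> C" if "z \<in> K1"
        using that closure_subset[of "fst ` K1"] closure_subset[of "snd ` K1"]
        by (auto simp: A_def C_def)
      then show "a z \<le> \<delta> + 2 * indicator (UNIV - K1) z"
        using wA(2)[of "fst z"] wC(2)[of "snd z"] wA(4) wC(4) by (auto simp: a_def indicator_def)
    qed
    also have "\<dots> = \<delta> * measure \<pi>p UNIV + 2 * measure \<pi>p (UNIV - K1)"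
      using K1 by (simp add: p.emeasure_eq_measure mult.commute)
    also have "(\<integral>z. b z \<partial>\<pi>m) \<le> (\<integral>z. indicator (UNIV - K2) z \<partial>\<pi>m)"
    proof (rule integral_mono)
      show "integrable \<pi>m b" using ab by (intro integrable_pi)
      show "integrable \<pi>m (indicator (UNIV - K2) :: _ \<Rightarrow> real)"
        using K2 by (auto intro!: integrable_real_indicator simp: m.emeasure_eq_measure)
      fix z
      have "fst z \<in> B" if "z \<in> K2"
        using that closure_subset[of "fst ` K2"] by (auto simp: B_def)
      then show "b z \<le> indicator (UNIV - K2) z"
        using wB(2)[of "fst z"] wB(4) by (auto simp: b_def indicator_def)
    qed
    also have "\<dots> = measure \<pi>m (UNIV - K2)" using K2 by simp
    finally show ?thesis using K1 K2 \<delta>e by simp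
  qed
  have "compact (A \<times> B \<times> C)" using A B C by (intro compact_Times)
  moreover have "closed (A \<times> B \<times> C)" unfolding A_def B_def C_def by (intro closed_Times closed_closure)
  ultimately show ?thesis using gauge_le by (intro exI[of _ "A \<times> B \<times> C"]) auto
qed

section \<open>From majorants of 1 to dual pairs\<close>

text \<open>A triple \<open>(a, b, u)\<close> majorizing \<open>1\<close> satisfies
  \<open>1 - b (y, s) + u y \<le> a (x, s) + u x\<close> for all \<open>x\<close>, \<open>y\<close>. The supremum \<open>v s\<close> of the left-hand side
  separates the two sides and is lower semicontinuous, so \<open>(- u, v)\<close> is an admissible dual pair up
  to replacing \<open>v\<close> by a continuous function close to it in both \<open>L\<^sup>1\<close> norms.\<close>

lemma dual_value_le_gauge:
  "(INF (u, v) \<in> (bcontfun :: ('x \<Rightarrow> real) set) \<times> (bcontfun :: ('s \<Rightarrow> real) set).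
     dual_cost \<pi>p \<pi>m u v) \<le> gauge (\<lambda>_. 1)" (is "?D \<le> _")
proof (rule gauge_greatest)
  fix a b u assume abu: "(a, b, u) \<in> majorants (\<lambda>_. 1)"
  then have ab: "a \<in> bcontfun" "b \<in> bcontfun" and u: "u \<in> bcontfun"
    and le: "\<And>x y s. 1 \<le> a (x, s) + b (y, s) + u x - u y" by (auto simp: majorants_def)
  show "?D \<le> cost a b"
  proof (rule field_le_epsilon)
    fix e :: real assume e: "e > 0"
    obtain cb cu where cb: "\<And>z. \<bar>b z\<bar> \<le> cb" and cu: "\<And>x. \<bar>u x\<bar> \<le> cu"
      using ab(2) u by (auto simp: bcontfun_def bounded_iff)
    define v where "v s = (SUP y. 1 - b (y, s) + u y)" for s
    have bnd: "\<bar>1 - b (y, s) + u y\<bar> \<le> 1 + cb + cu" for y s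
      using cb[of "(y, s)"] cu[of y] by linarith
    then have bdd: "bdd_above (range (\<lambda>y. 1 - b (y, s) + u y))" for s
      by (intro bdd_aboveI2[of _ _ "1 + cb + cu"]) (auto simp: abs_le_iff)
    have v_ge: "1 - b (y, s) + u y \<le> v s" for y s
      unfolding v_def by (intro cSUP_upper bdd) auto
    have v_le: "v s \<le> c" if "\<And>y. 1 - b (y, s) + u y \<le> c" for s c
      unfolding v_def using that by (intro cSUP_least) auto
    have vb: "\<bar>v s\<bar> \<le> 1 + cb + cu" for s
    proof -
      have "v s \<le> 1 + cb + cu" using bnd by (intro v_le) (auto simp: abs_le_iff)
      \<comment> \<open>Any single value of \<open>y\<close> bounds the supremum from below;
        \<open>undefined\<close> is merely some point of the type.\<close>
      moreover have "- (1 + cb + cu) \<le> v s"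
        using v_ge[of undefined s] bnd[of undefined s] by (simp add: abs_le_iff)
      ultimately show ?thesis by (simp add: abs_le_iff)
    qed
    have lsc: "open {s. c < v s}" for c
    proof -
      have "{s. c < v s} = (\<Union>y. {s. c < 1 - b (y, s) + u y})"
        unfolding v_def using bdd by (auto simp: less_cSUP_iff)
      moreover have "open {s. c < 1 - b (y, s) + u y}" for y
      proof (intro open_Collect_less continuous_intros)
        show "continuous_on UNIV (\<lambda>s. b (y, s))"
          using ab(2) by (auto simp: bcontfun_def intro!: continuous_on_compose2[of UNIV b] continuous_intros)
      qed
      ultimately show ?thesis by auto
    qed
    obtain w :: "'s \<Rightarrow> real" where w: "w \<in> bcontfun"
      "(\<integral>z. \<bar>v (snd z) - w (snd z)\<bar> \<partial>\<pi>p) \<le> e / 2" "(\<integral>z. \<bar>v (snd z) - w (snd z)\<bar> \<partial>\<pi>m) \<le> e / 2"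
      using lower_semicontinuous_approximation[OF crS rp rm _ lsc vb, of snd "e / 2"] e
        continuous_on_snd[OF continuous_on_id] by auto
    have snd_m: "snd \<in> borel_measurable (borel :: ('x \<times> 's) measure)"
      by (intro borel_measurable_continuous_onI continuous_intros)
    have vm: "(\<lambda>z :: 'x \<times> 's. \<bar>v (snd z) - w (snd z)\<bar>) \<in> borel_measurable borel"
      using measurable_compose[OF snd_m lower_semicontinuous_borel[OF lsc]]
        measurable_compose[OF snd_m bcontfun_borel_measurable[OF w(1)]] by measurable
    obtain cw where cw: "\<And>s. \<bar>w s\<bar> \<le> cw" using w(1) by (auto simp: bcontfun_def bounded_iff)
    have "\<bar>v (snd z) - w (snd z)\<bar> \<le> 1 + cb + cu + cw" for z :: "'x \<times> 's"
      using vb[of "snd z"] cw[of "snd z"] by linarith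
    then have bd: "bounded (range (\<lambda>z :: 'x \<times> 's. \<bar>v (snd z) - w (snd z)\<bar>))"
      unfolding bounded_iff by (intro exI[of _ "1 + cb + cu + cw"]) auto
    note vi = integrable_bounded_borel[OF p.finite_measure_axioms sets_pi(1) vm bd]
      integrable_bounded_borel[OF m.finite_measure_axioms sets_pi(2) vm bd]
    have uf: "(\<lambda>z. u (fst z)) \<in> bcontfun" and ws: "(\<lambda>z. w (snd z)) \<in> bcontfun"
      using u w(1) by (auto intro!: compose_bcontfun[where g = fst] compose_bcontfun[where g = snd]
          continuous_intros)
    \<comment> \<open>Since \<open>v s\<close> is the least upper bound over \<open>y\<close>, it is
      at most \<open>a (x, s) + u x\<close>; passing from \<open>v\<close> to \<open>w\<close> costs
      \<open>\<bar>v - w\<bar>\<close>. For \<open>\<pi>m\<close> below, the upper bound property of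
      \<open>v\<close> plays the corresponding part.\<close>
    have "(\<integral>z. max (- u (fst z) + w (snd z)) 0 \<partial>\<pi>p) \<le> (\<integral>z. max (a z) 0 + \<bar>v (snd z) - w (snd z)\<bar> \<partial>\<pi>p)"
    proof (rule integral_mono)
      show "integrable \<pi>p (\<lambda>z. max (- u (fst z) + w (snd z)) 0)"
        by (intro integrable_pi bcontfun_intros uf ws)
      show "integrable \<pi>p (\<lambda>z. max (a z) 0 + \<bar>v (snd z) - w (snd z)\<bar>)"
        by (intro Bochner_Integration.integrable_add vi integrable_pi bcontfun_intros ab)
      fix z :: "'x \<times> 's"
      have "v (snd z) \<le> a z + u (fst z)"
      proof (rule v_le)
        show "1 - b (y, snd z) + u y \<le> a z + u (fst z)" for y
          using le[of "fst z" "snd z" y] by simp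
      qed
      then show "max (- u (fst z) + w (snd z)) 0 \<le> max (a z) 0 + \<bar>v (snd z) - w (snd z)\<bar>" by linarith
    qed
    also have "\<dots> = (\<integral>z. max (a z) 0 \<partial>\<pi>p) + (\<integral>z. \<bar>v (snd z) - w (snd z)\<bar> \<partial>\<pi>p)"
      by (intro Bochner_Integration.integral_add vi integrable_pi bcontfun_intros ab)
    finally have 1: "(\<integral>z. max (- u (fst z) + w (snd z)) 0 \<partial>\<pi>p) \<le> (\<integral>z. max (a z) 0 \<partial>\<pi>p) + e / 2"
      using w(2) by simp
    have "(\<integral>z. max (1 - - u (fst z) - w (snd z)) 0 \<partial>\<pi>m) \<le> (\<integral>z. max (b z) 0 + \<bar>v (snd z) - w (snd z)\<bar> \<partial>\<pi>m)"
    proof (rule integral_mono)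
      show "integrable \<pi>m (\<lambda>z. max (1 - - u (fst z) - w (snd z)) 0)"
        by (intro integrable_pi bcontfun_intros uf ws)
      show "integrable \<pi>m (\<lambda>z. max (b z) 0 + \<bar>v (snd z) - w (snd z)\<bar>)"
        by (intro Bochner_Integration.integrable_add vi integrable_pi bcontfun_intros ab)
      fix z :: "'x \<times> 's"
      show "max (1 - - u (fst z) - w (snd z)) 0 \<le> max (b z) 0 + \<bar>v (snd z) - w (snd z)\<bar>"
        using v_ge[of "fst z" "snd z"] by simp
    qed
    also have "\<dots> = (\<integral>z. max (b z) 0 \<partial>\<pi>m) + (\<integral>z. \<bar>v (snd z) - w (snd z)\<bar> \<partial>\<pi>m)"
      by (intro Bochner_Integration.integral_add vi integrable_pi bcontfun_intros ab)
    finally have 2: "(\<integral>z. max (1 - - u (fst z) - w (snd z)) 0 \<partial>\<pi>m) \<le> (\<integral>z. max (b z) 0 \<partial>\<pi>m) + e / 2"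
      using w(3) by simp
    have "?D \<le> dual_cost \<pi>p \<pi>m (\<lambda>x. - u x) w"
    proof (rule cINF_lower2[where x = "(\<lambda>x. - u x, w)"])
      show "bdd_below ((\<lambda>(u, v). dual_cost \<pi>p \<pi>m u v) ` (bcontfun \<times> bcontfun))"
        by (rule bdd_belowI2[of _ 0])
          (auto simp: dual_cost_def case_prod_unfold intro!: add_nonneg_nonneg integral_nonneg)
    qed (use u w(1) uminus_cont in auto)
    also have "\<dots> \<le> cost a b + e" using 1 2 by (simp add: dual_cost_def cost_def case_prod_unfold)
    finally show "?D \<le> cost a b + e" .
  qed
qed (rule const_bcontfun)

section \<open>Weak duality and a plan whose mass is the gauge of 1\<close>

lemma continuous_projections:
  "continuous_on UNIV (\<lambda>z :: 'x \<times> 'x \<times> 's. (fst z, snd (snd z)))"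
  "continuous_on UNIV (snd :: 'x \<times> 'x \<times> 's \<Rightarrow> 'x \<times> 's)"
  "continuous_on UNIV (fst :: 'x \<times> 'x \<times> 's \<Rightarrow> 'x)"
  "continuous_on UNIV (\<lambda>z :: 'x \<times> 'x \<times> 's. fst (snd z))"
  by (intro continuous_intros)+

lemma weak_duality:
  assumes \<gamma>: "\<gamma> \<in> exchange_plans \<pi>p \<pi>m" and u: "u \<in> bcontfun" and v: "v \<in> bcontfun"
  shows "measure \<gamma> UNIV \<le> dual_cost \<pi>p \<pi>m u v"
proof -
  let ?p = "\<lambda>z :: 'x \<times> 'x \<times> 's. (fst z, snd (snd z))"
  have r: "\<gamma> \<in> radon_measures"
    and lp: "\<And>B. B \<in> sets borel \<Longrightarrow> emeasure (distr \<gamma> borel ?p) B \<le> emeasure \<pi>p B"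
    and lm: "\<And>B. B \<in> sets borel \<Longrightarrow> emeasure (distr \<gamma> borel snd) B \<le> emeasure \<pi>m B"
    and eq: "distr \<gamma> borel fst = distr \<gamma> borel (\<lambda>z. fst (snd z))"
    using \<gamma> unfolding exchange_plans_def distr_projections by auto
  interpret finite_measure \<gamma> using radon_measuresD[OF r] by blast
  have [simp]: "sets \<gamma> = sets borel" "space \<gamma> = UNIV" using radon_measuresD[OF r] by auto
  note proj = continuous_borel_measurable[OF \<open>sets \<gamma> = sets borel\<close> continuous_projections(1)]
    continuous_borel_measurable[OF \<open>sets \<gamma> = sets borel\<close> continuous_projections(2)]
    continuous_borel_measurable[OF \<open>sets \<gamma> = sets borel\<close> continuous_projections(3)]
    continuous_borel_measurable[OF \<open>sets \<gamma> = sets borel\<close> continuous_projections(4)]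
  define f where "f z = max (u (fst z) + v (snd z)) 0" for z
  define g where "g z = max (1 - u (fst z) - v (snd z)) 0" for z
  have uf: "(\<lambda>z. u (fst z)) \<in> bcontfun" and vs: "(\<lambda>z. v (snd z)) \<in> bcontfun"
    using u v by (auto intro!: compose_bcontfun[where g = fst] compose_bcontfun[where g = snd]
        continuous_intros)
  have fb: "f \<in> bcontfun" and gb: "g \<in> bcontfun"
    unfolding f_def g_def by (intro bcontfun_intros uf vs)+
  have f0: "0 \<le> f z" and g0: "0 \<le> g z" for z by (simp_all add: f_def g_def)
  have int: "integrable \<gamma> (\<lambda>z. h (r z))"
    if "h \<in> bcontfun" "continuous_on UNIV r" for h :: "'c::topological_space \<Rightarrow> real" and r
    using that finite_measure_axioms by (intro integrable_bcontfun_compose) auto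
  have "(\<integral>x. u x \<partial>distr \<gamma> borel fst) = (\<integral>x. u x \<partial>distr \<gamma> borel (\<lambda>z. fst (snd z)))"
    by (simp only: eq)
  then have ueq: "(\<integral>z. u (fst z) \<partial>\<gamma>) = (\<integral>z. u (fst (snd z)) \<partial>\<gamma>)"
    using proj(3,4) bcontfun_borel_measurable[OF u] by (simp add: integral_distr)
  have "measure \<gamma> UNIV = (\<integral>z. 1 \<partial>\<gamma>) + ((\<integral>z. u (fst z) \<partial>\<gamma>) - (\<integral>z. u (fst (snd z)) \<partial>\<gamma>))"
    using ueq by simp
  also have "\<dots> = (\<integral>z. 1 + (u (fst z) - u (fst (snd z))) \<partial>\<gamma>)"
    using int[OF u continuous_projections(3)] int[OF u continuous_projections(4)] by simp
  also have "\<dots> \<le> (\<integral>z. f (?p z) + g (snd z) \<partial>\<gamma>)"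
  proof (rule integral_mono)
    show "integrable \<gamma> (\<lambda>z. 1 + (u (fst z) - u (fst (snd z))))"
      using int[OF u continuous_projections(3)] int[OF u continuous_projections(4)] by simp
    show "integrable \<gamma> (\<lambda>z. f (?p z) + g (snd z))"
      by (intro Bochner_Integration.integrable_add int[OF fb continuous_projections(1)]
          int[OF gb continuous_projections(2)])
    show "1 + (u (fst z) - u (fst (snd z))) \<le> f (?p z) + g (snd z)" for z :: "'x \<times> 'x \<times> 's"
      by (simp add: f_def g_def)
  qed
  also have "\<dots> = (\<integral>z. f (?p z) \<partial>\<gamma>) + (\<integral>z. g (snd z) \<partial>\<gamma>)"
    by (intro Bochner_Integration.integral_add int[OF fb continuous_projections(1)]
        int[OF gb continuous_projections(2)])
  also have "(\<integral>z. f (?p z) \<partial>\<gamma>) = (\<integral>z. f z \<partial>distr \<gamma> borel ?p)"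
    using integral_distr[OF proj(1) bcontfun_borel_measurable[OF fb]] by simp
  also have "\<dots> \<le> (\<integral>z. f z \<partial>\<pi>p)"
    using finite_measure_distr[OF proj(1)] p.finite_measure_axioms fb lp f0
    by (intro integral_mono_dominated_measure) auto
  also have "(\<integral>z. g (snd z) \<partial>\<gamma>) = (\<integral>z. g z \<partial>distr \<gamma> borel snd)"
    using integral_distr[OF proj(2) bcontfun_borel_measurable[OF gb]] by simp
  also have "\<dots> \<le> (\<integral>z. g z \<partial>\<pi>m)"
    using finite_measure_distr[OF proj(2)] m.finite_measure_axioms gb lm g0
    by (intro integral_mono_dominated_measure) auto
  finally show ?thesis by (simp add: dual_cost_def f_def g_def case_prod_unfold)
qed

text \<open>Every property of the plan is the bound \<open>L \<le> gauge\<close> tested on one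
  simple majorant: (0, 0, 0) majorizes \<open>- f\<close> for positivity, (w, 0, 0) and (0, w, 0)
  with \<open>w \<ge> 0\<close> give the dominated marginals, and (0, 0, w), of cost 0, gives the
  equality of the \<open>X\<close> and \<open>Y\<close> marginals.\<close>

lemma gauge_attained:
  obtains \<gamma> where "\<gamma> \<in> exchange_plans \<pi>p \<pi>m" "measure \<gamma> UNIV = gauge (\<lambda>_. 1)"
proof -
  obtain L where add: "\<And>f g. f \<in> bcontfun \<Longrightarrow> g \<in> bcontfun \<Longrightarrow> L (\<lambda>z. f z + g z) = L f + L g"
    and scale: "\<And>f c. f \<in> bcontfun \<Longrightarrow> L (\<lambda>z. c * f z) = c * L f"
    and le: "\<And>f. f \<in> bcontfun \<Longrightarrow> L f \<le> gauge f"
    and one: "L (\<lambda>_. 1 :: real) = gauge (\<lambda>_. 1)"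
    using gauge_functional by blast
  have L_le: "L f \<le> cost a b" if "f \<in> bcontfun" "(a, b, u) \<in> majorants f" for f a b u
    using le[OF that(1)] gauge_lower[OF that(2)] by simp
  interpret tight_functional L
  proof
    show "completely_regular_space (euclidean :: ('x \<times> 'x \<times> 's) topology)" by (rule crXXS)
    show "0 \<le> L f" if f: "f \<in> bcontfun" "\<And>z. 0 \<le> f z" for f
    proof -
      have "(\<lambda>_. 0, \<lambda>_. 0, \<lambda>_. 0) \<in> majorants (\<lambda>z. (- 1) * f z)"
        using f by (simp add: majorants_def const_bcontfun)
      then have "L (\<lambda>z. (- 1) * f z) \<le> cost (\<lambda>_. 0) (\<lambda>_. 0)" using f by (intro L_le scaled_bcontfun)
      then show ?thesis using scale[OF f(1), of "- 1"] by (simp add: cost_def)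
    qed
    show "\<exists>K. compact K \<and> closed K \<and>
        (\<forall>f\<in>bcontfun. (\<forall>z. 0 \<le> f z \<and> f z \<le> 1) \<longrightarrow> (\<forall>z\<in>K. f z = 0) \<longrightarrow> L f \<le> e)" if "e > 0" for e
      using gauge_tight[OF that] le by (meson order_trans)
  qed (fact add scale)+
  let ?\<gamma> = riesz_measure
  let ?p = "\<lambda>z :: 'x \<times> 'x \<times> 's. (fst z, snd (snd z))"
  have "emeasure (distr ?\<gamma> borel ?p) B \<le> emeasure \<pi>p B" if "B \<in> sets borel" for B
  proof (rule distr_le_radon[OF crXS riesz_measure_radon continuous_projections(1) rp _ that])
    fix w :: "'x \<times> 's \<Rightarrow> real" assume w: "w \<in> bcontfun" "\<And>x. 0 \<le> w x"
    have wb: "(\<lambda>z. w (?p z)) \<in> bcontfun"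
      using w(1) continuous_projections(1) by (rule compose_bcontfun)
    have "(w, \<lambda>_. 0, \<lambda>_. 0) \<in> majorants (\<lambda>z. w (?p z))"
      using w by (simp add: majorants_def const_bcontfun)
    from L_le[OF wb this] show "(\<integral>z. w (?p z) \<partial>?\<gamma>) \<le> (\<integral>z. w z \<partial>\<pi>p)"
      using w(2) integral_riesz_measure[OF wb] by (simp add: cost_def)
  qed
  moreover have "emeasure (distr ?\<gamma> borel snd) B \<le> emeasure \<pi>m B" if "B \<in> sets borel" for B
  proof (rule distr_le_radon[OF crXS riesz_measure_radon continuous_projections(2) rm _ that])
    fix w :: "'x \<times> 's \<Rightarrow> real" assume w: "w \<in> bcontfun" "\<And>x. 0 \<le> w x"
    have wb: "(\<lambda>z :: 'x \<times> 'x \<times> 's. w (snd z)) \<in> bcontfun"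
      using w(1) continuous_projections(2) by (rule compose_bcontfun)
    have "(\<lambda>_. 0, w, \<lambda>_. 0) \<in> majorants (\<lambda>z. w (snd z))"
      using w by (simp add: majorants_def const_bcontfun)
    from L_le[OF wb this] show "(\<integral>z. w (snd z) \<partial>?\<gamma>) \<le> (\<integral>z. w z \<partial>\<pi>m)"
      using w(2) integral_riesz_measure[OF wb] by (simp add: cost_def)
  qed
  moreover have "distr ?\<gamma> borel fst = distr ?\<gamma> borel (\<lambda>z. fst (snd z))"
  proof (rule distr_eqI_bcontfun[OF crX riesz_measure_radon continuous_projections(3,4)])
    have *: "L (\<lambda>z. w (fst z)) \<le> L (\<lambda>z. w (fst (snd z)))" if w: "w \<in> bcontfun" for w :: "'x \<Rightarrow> real"
    proof -
      have wb: "(\<lambda>z :: 'x \<times> 'x \<times> 's. w (fst z)) \<in> bcontfun"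
        "(\<lambda>z :: 'x \<times> 'x \<times> 's. w (fst (snd z))) \<in> bcontfun"
        using compose_bcontfun[OF w continuous_projections(3)]
          compose_bcontfun[OF w continuous_projections(4)] by auto
      have "(\<lambda>_. 0, \<lambda>_. 0, w) \<in> majorants (\<lambda>z. w (fst z) - w (fst (snd z)))"
        using w by (simp add: majorants_def const_bcontfun)
      from L_le[OF minus_cont[OF wb] this] show ?thesis using diff[OF wb] by (simp add: cost_def)
    qed
    fix w :: "'x \<Rightarrow> real" assume w: "w \<in> bcontfun"
    have wb: "(\<lambda>z :: 'x \<times> 'x \<times> 's. w (fst z)) \<in> bcontfun"
        "(\<lambda>z :: 'x \<times> 'x \<times> 's. w (fst (snd z))) \<in> bcontfun"
      using compose_bcontfun[OF w continuous_projections(3)]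
        compose_bcontfun[OF w continuous_projections(4)] by auto
    \<comment> \<open>The inequality for \<open>- w\<close> supplies the other direction.\<close>
    have "L (\<lambda>z. w (fst (snd z))) \<le> L (\<lambda>z. w (fst z))"
      using *[OF scaled_bcontfun[OF w, of "- 1"]] scale[OF wb(1), of "- 1"] scale[OF wb(2), of "- 1"]
      by simp
    with *[OF w] show "(\<integral>z. w (fst z) \<partial>?\<gamma>) = (\<integral>z. w (fst (snd z)) \<partial>?\<gamma>)"
      using integral_riesz_measure[OF wb(1)] integral_riesz_measure[OF wb(2)] by simp
  qed
  ultimately have "?\<gamma> \<in> exchange_plans \<pi>p \<pi>m"
    using riesz_measure_radon unfolding exchange_plans_def distr_projections by auto
  moreover have "measure ?\<gamma> UNIV = gauge (\<lambda>_. 1)"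
    using integral_riesz_measure[of "\<lambda>_. 1"] one by (simp add: const_bcontfun)
  ultimately show thesis by (rule that)
qed

end

theorem theorem3p6:
  fixes \<pi>p \<pi>m :: "('x::topological_space \<times> 's::topological_space) measure"
  assumes "completely_regular_space (euclidean :: 'x topology)"
    and "completely_regular_space (euclidean :: 's topology)"
    and "\<pi>p \<in> radon_measures" and "\<pi>m \<in> radon_measures"
  shows "\<exists>\<gamma> \<in> exchange_plans \<pi>p \<pi>m.
           (\<forall>\<gamma>' \<in> exchange_plans \<pi>p \<pi>m. measure \<gamma>' UNIV \<le> measure \<gamma> UNIV) \<and>
           measure \<gamma> UNIV =
             (INF (u, v) \<in> (bcontfun :: ('x \<Rightarrow> real) set) \<times> (bcontfun :: ('s \<Rightarrow> real) set).
                dual_cost \<pi>p \<pi>m u v)"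
proof -
  interpret exchange_problem \<pi>p \<pi>m using assms by unfold_locales
  let ?D = "INF (u, v) \<in> (bcontfun :: ('x \<Rightarrow> real) set) \<times> (bcontfun :: ('s \<Rightarrow> real) set).
    dual_cost \<pi>p \<pi>m u v"
  have le: "measure \<gamma>' UNIV \<le> ?D" if "\<gamma>' \<in> exchange_plans \<pi>p \<pi>m" for \<gamma>'
  proof (rule cINF_greatest)
    show "(bcontfun :: ('x \<Rightarrow> real) set) \<times> (bcontfun :: ('s \<Rightarrow> real) set) \<noteq> {}"
      using const_bcontfun by (metis SigmaI empty_iff)
  qed (use weak_duality[OF that] in auto)
  obtain \<gamma> where \<gamma>: "\<gamma> \<in> exchange_plans \<pi>p \<pi>m" "measure \<gamma> UNIV = gauge (\<lambda>_. 1)"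
    using gauge_attained .
  \<comment> \<open>The chain closes: the mass of this plan is at most \<open>?D\<close> by weak
    duality, and \<open>?D\<close> is at most the gauge of 1, which is the mass again.\<close>
  then have "measure \<gamma> UNIV = ?D" using le[OF \<gamma>(1)] dual_value_le_gauge by simp
  with \<gamma>(1) le show ?thesis by (intro bexI[of _ \<gamma>] conjI ballI) simp_all
qed

end
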